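(* Let $\mathcal{T}$ be a universe and assume $\Omega$-resizing for $\mathcal{T}$. Then for every type $D:\mathcal{T}$, the $\mathcal{T},\mathcal{T}$-injectivity of $D$ is equivalent to the propositional truncation of its algebraic $\mathcal{T},\mathcal{T}$-injectivity, i.e. $$D \text{ is } \mathcal{T},\mathcal{T}\text{-injective} \iff \| D \text{ is algebraically } \mathcal{T},\mathcal{T}\text{-injective}\|.$$
   Context: Foundation: intensional Martin-Löf type theory with $\mathbb{0},\mathbb{1},\mathbb{N},+,\Pi,\Sigma,\mathrm{Id}$ and universes $\mathcal{U},\mathcal{V},\mathcal{W},\mathcal{T}$ (not assumed cumulative), with successor $\mathcal{U}^+$ and least upper bound $\mathcal{U}\sqcup\mathcal{V}$; if $X:\mathcal{U}$ and $A:X\to\mathcal{V}$ then $\Pi A,\Sigma A:\mathcal{U}\sqcup\mathcal{V}$. Univalence (hence function and propositional extensionality) and existence of propositional truncations ($\|X\|:\mathcal{U}$ for $X:\mathcal{U}$, eliminating into propositions of any universe) are assumed. Excluded middle is neither assumed nor rejected. A proposition (subsingleton) is a type any two of whose elements are equal. A map $j:X\to Y$ is an embedding if each fiber $j^{-1}(y):=\Sigma(x:X),\,j\,x=y$ is a subsingleton; $X\hookrightarrow Y$ is the type of embeddings. $f\sim g$ means pointwise equality. $\exists$ is the propositional truncation of $\Sigma$. A type $D$ (in any universe) is $\mathcal{U},\mathcal{V}$-injective if $$\Pi(X:\mathcal{U})\,\Pi(Y:\mathcal{V})\,\Pi(j:X\hookrightarrow Y)\,\Pi(f:X\to D),\ \exists(g:Y\to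 D),\ g\circ j\sim f,$$ and algebraically $\mathcal{U},\mathcal{V}$-injective if it is equipped with an element of $$\Pi(X:\mathcal{U})\,\Pi(Y:\mathcal{V})\,\Pi(j:X\hookrightarrow Y)\,\Pi(f:X\to D),\ \Sigma(g:Y\to D),\ g\circ j\sim f.$$ $\Omega_{\mathcal{T}}:\mathcal{T}^+$ is the type of propositions in $\mathcal{T}$. $\Omega$-resizing for $\mathcal{T}$ says that $\Omega_{\mathcal{T}}$ has an equivalent copy in $\mathcal{T}$, i.e. there is $\Omega':\mathcal{T}$ with an equivalence $\Omega'\simeq\Omega_{\mathcal{T}}$. *)

theory Defs
  imports Main
begin

text \<open>
  The ambient foundation is a type theory, not HOL, so it is embedded deeply: raw syntax with
  de Bruijn indices, conversion, and an inductively defined typing judgement. A theorem of the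
  type theory is the statement that a type is inhabited by a closed term. (A shallow embedding
  that represents binders by HOL functions would be inconsistent with univalence, because HOL
  functions can decide equality.)
\<close>

section \<open>Universe levels\<close>

text \<open>
  Only the structure that is used on universes is required: a strictly larger successor and
  least upper bounds. Universes need not be linearly ordered. The order is not cumulativity; it only
  provides the laws of least upper bounds, e.g. that the universe of level
  \<open>sup l (lsuc l)\<close> is the one of level \<open>lsuc l\<close>.
\<close>

class universe_level = semilattice_sup +
  fixes lsuc :: "'a \<Rightarrow> 'a"
  assumes less_lsuc: "l < lsuc l"

instantiation nat :: universe_level
begin
definition "lsuc_nat = Suc"
instance by standard (simp add: lsuc_nat_def)
end


section \<open>Raw syntax\<close>

text \<open>
  Numbers of variables bound in the arguments: one in the second argument of \<open>TPi\<close>, \<open>TSig\<close>,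
  \<open>Lam\<close>, \<open>MkPair\<close>; one in the motive (first argument) of every eliminator except \<open>J\<close>, whose
  motive binds two; one in each branch of \<open>SumElim\<close>; two in the branch of \<open>SigElim\<close> and in the
  successor branch of \<open>NatElim\<close>. The last three constants are the univalence and truncation
  assumptions. Since universes are not cumulative, each universe has its own copy of the
  types \<open>TEmpty\<close>, \<open>TUnit\<close>, \<open>TNat\<close>.
\<close>

datatype 'l tm =
    Var nat
  | TUniv 'l
  | TEmpty 'l
  | EmptyElim "'l tm" "'l tm"
  | TUnit 'l
  | Star 'l
  | UnitElim "'l tm" "'l tm" "'l tm"
  | TNat 'l
  | Zero 'l
  | Succ "'l tm"
  | NatElim "'l tm" "'l tm" "'l tm" "'l tm"
  | TSum "'l tm" "'l tm"
  | InL "'l tm" "'l tm" "'l tm"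
  | InR "'l tm" "'l tm" "'l tm"
  | SumElim "'l tm" "'l tm" "'l tm" "'l tm"
  | TPi "'l tm" "'l tm"
  | Lam "'l tm" "'l tm"
  | App "'l tm" "'l tm"
  | TSig "'l tm" "'l tm"
  | MkPair "'l tm" "'l tm" "'l tm" "'l tm"
  | SigElim "'l tm" "'l tm" "'l tm"
  | TId "'l tm" "'l tm" "'l tm"
  | Refl "'l tm" "'l tm"
  | J "'l tm" "'l tm" "'l tm"
  | TTrunc "'l tm"
  | TrIn "'l tm" "'l tm"
  | TrProp "'l tm"
  | TrRec "'l tm" "'l tm"
  | Univalence 'l

definition up_ren :: "(nat \<Rightarrow> nat) \<Rightarrow> nat \<Rightarrow> nat" where
  "up_ren \<rho> = case_nat 0 (\<lambda>i. Suc (\<rho> i))"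

primrec ren :: "(nat \<Rightarrow> nat) \<Rightarrow> 'l tm \<Rightarrow> 'l tm" where
  "ren \<rho> (Var i) = Var (\<rho> i)"
| "ren \<rho> (TUniv l) = TUniv l"
| "ren \<rho> (TEmpty l) = TEmpty l"
| "ren \<rho> (EmptyElim C t) = EmptyElim (ren (up_ren \<rho>) C) (ren \<rho> t)"
| "ren \<rho> (TUnit l) = TUnit l"
| "ren \<rho> (Star l) = Star l"
| "ren \<rho> (UnitElim C c t) = UnitElim (ren (up_ren \<rho>) C) (ren \<rho> c) (ren \<rho> t)"
| "ren \<rho> (TNat l) = TNat l"
| "ren \<rho> (Zero l) = Zero l"
| "ren \<rho> (Succ n) = Succ (ren \<rho> n)"
| "ren \<rho> (NatElim C z s n) =
     NatElim (ren (up_ren \<rho>) C) (ren \<rho> z) (ren (up_ren (up_ren \<rho>)) s) (ren \<rho> n)"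
| "ren \<rho> (TSum A B) = TSum (ren \<rho> A) (ren \<rho> B)"
| "ren \<rho> (InL A B a) = InL (ren \<rho> A) (ren \<rho> B) (ren \<rho> a)"
| "ren \<rho> (InR A B b) = InR (ren \<rho> A) (ren \<rho> B) (ren \<rho> b)"
| "ren \<rho> (SumElim C f g t) =
     SumElim (ren (up_ren \<rho>) C) (ren (up_ren \<rho>) f) (ren (up_ren \<rho>) g) (ren \<rho> t)"
| "ren \<rho> (TPi A B) = TPi (ren \<rho> A) (ren (up_ren \<rho>) B)"
| "ren \<rho> (Lam A t) = Lam (ren \<rho> A) (ren (up_ren \<rho>) t)"
| "ren \<rho> (App f a) = App (ren \<rho> f) (ren \<rho> a)"
| "ren \<rho> (TSig A B) = TSig (ren \<rho> A) (ren (up_ren \<rho>) B)"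
| "ren \<rho> (MkPair A B a b) = MkPair (ren \<rho> A) (ren (up_ren \<rho>) B) (ren \<rho> a) (ren \<rho> b)"
| "ren \<rho> (SigElim C f p) =
     SigElim (ren (up_ren \<rho>) C) (ren (up_ren (up_ren \<rho>)) f) (ren \<rho> p)"
| "ren \<rho> (TId A a b) = TId (ren \<rho> A) (ren \<rho> a) (ren \<rho> b)"
| "ren \<rho> (Refl A a) = Refl (ren \<rho> A) (ren \<rho> a)"
| "ren \<rho> (J C c p) = J (ren (up_ren (up_ren \<rho>)) C) (ren \<rho> c) (ren \<rho> p)"
| "ren \<rho> (TTrunc A) = TTrunc (ren \<rho> A)"
| "ren \<rho> (TrIn A a) = TrIn (ren \<rho> A) (ren \<rho> a)"
| "ren \<rho> (TrProp A) = TrProp (ren \<rho> A)"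
| "ren \<rho> (TrRec A P) = TrRec (ren \<rho> A) (ren \<rho> P)"
| "ren \<rho> (Univalence l) = Univalence l"

definition wk :: "nat \<Rightarrow> 'l tm \<Rightarrow> 'l tm" where
  "wk n = ren (\<lambda>i. i + n)"

definition up :: "(nat \<Rightarrow> 'l tm) \<Rightarrow> nat \<Rightarrow> 'l tm" where
  "up \<sigma> = case_nat (Var 0) (\<lambda>i. wk 1 (\<sigma> i))"

primrec subst :: "(nat \<Rightarrow> 'l tm) \<Rightarrow> 'l tm \<Rightarrow> 'l tm" where
  "subst \<sigma> (Var i) = \<sigma> i"
| "subst \<sigma> (TUniv l) = TUniv l"
| "subst \<sigma> (TEmpty l) = TEmpty l"
| "subst \<sigma> (EmptyElim C t) = EmptyElim (subst (up \<sigma>) C) (subst \<sigma> t)"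
| "subst \<sigma> (TUnit l) = TUnit l"
| "subst \<sigma> (Star l) = Star l"
| "subst \<sigma> (UnitElim C c t) = UnitElim (subst (up \<sigma>) C) (subst \<sigma> c) (subst \<sigma> t)"
| "subst \<sigma> (TNat l) = TNat l"
| "subst \<sigma> (Zero l) = Zero l"
| "subst \<sigma> (Succ n) = Succ (subst \<sigma> n)"
| "subst \<sigma> (NatElim C z s n) =
     NatElim (subst (up \<sigma>) C) (subst \<sigma> z) (subst (up (up \<sigma>)) s) (subst \<sigma> n)"
| "subst \<sigma> (TSum A B) = TSum (subst \<sigma> A) (subst \<sigma> B)"
| "subst \<sigma> (InL A B a) = InL (subst \<sigma> A) (subst \<sigma> B) (subst \<sigma> a)"
| "subst \<sigma> (InR A B b) = InR (subst \<sigma> A) (subst \<sigma> B) (subst \<sigma> b)"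
| "subst \<sigma> (SumElim C f g t) =
     SumElim (subst (up \<sigma>) C) (subst (up \<sigma>) f) (subst (up \<sigma>) g) (subst \<sigma> t)"
| "subst \<sigma> (TPi A B) = TPi (subst \<sigma> A) (subst (up \<sigma>) B)"
| "subst \<sigma> (Lam A t) = Lam (subst \<sigma> A) (subst (up \<sigma>) t)"
| "subst \<sigma> (App f a) = App (subst \<sigma> f) (subst \<sigma> a)"
| "subst \<sigma> (TSig A B) = TSig (subst \<sigma> A) (subst (up \<sigma>) B)"
| "subst \<sigma> (MkPair A B a b) =
     MkPair (subst \<sigma> A) (subst (up \<sigma>) B) (subst \<sigma> a) (subst \<sigma> b)"
| "subst \<sigma> (SigElim C f p) =
     SigElim (subst (up \<sigma>) C) (subst (up (up \<sigma>)) f) (subst \<sigma> p)"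
| "subst \<sigma> (TId A a b) = TId (subst \<sigma> A) (subst \<sigma> a) (subst \<sigma> b)"
| "subst \<sigma> (Refl A a) = Refl (subst \<sigma> A) (subst \<sigma> a)"
| "subst \<sigma> (J C c p) = J (subst (up (up \<sigma>)) C) (subst \<sigma> c) (subst \<sigma> p)"
| "subst \<sigma> (TTrunc A) = TTrunc (subst \<sigma> A)"
| "subst \<sigma> (TrIn A a) = TrIn (subst \<sigma> A) (subst \<sigma> a)"
| "subst \<sigma> (TrProp A) = TrProp (subst \<sigma> A)"
| "subst \<sigma> (TrRec A P) = TrRec (subst \<sigma> A) (subst \<sigma> P)"
| "subst \<sigma> (Univalence l) = Univalence l"

text \<open>
  \<open>inst_under n t a\<close> replaces variable 0 of \<open>t\<close> by \<open>a\<close>, where \<open>a\<close> lives in the context of \<open>t\<close>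
  with variable 0 removed and \<open>n\<close> further variables added. \<open>inst2 t a b\<close> replaces variable 1
  of \<open>t\<close> by \<open>a\<close> and variable 0 by \<open>b\<close>.
\<close>

definition inst_under :: "nat \<Rightarrow> 'l tm \<Rightarrow> 'l tm \<Rightarrow> 'l tm" where
  "inst_under n t a = subst (case_nat a (\<lambda>i. Var (i + n))) t"

definition inst :: "'l tm \<Rightarrow> 'l tm \<Rightarrow> 'l tm" where
  "inst t a = inst_under 0 t a"

definition inst2 :: "'l tm \<Rightarrow> 'l tm \<Rightarrow> 'l tm \<Rightarrow> 'l tm" where
  "inst2 t a b = subst (case_nat b (case_nat a Var)) t"


section \<open>Conversion\<close>

text \<open>
  Definitional equality is presented as for pure type systems: the congruence generated on raw
  terms by the computation rules of all eliminators and the eta rule for functions. The typing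
  rule that uses it requires both types to be well-formed.
\<close>

inductive conv :: "'l tm \<Rightarrow> 'l tm \<Rightarrow> bool"  (infix "\<approx>" 50) where
  conv_refl: "t \<approx> t"
| conv_sym: "t \<approx> u \<Longrightarrow> u \<approx> t"
| conv_trans: "t \<approx> u \<Longrightarrow> u \<approx> v \<Longrightarrow> t \<approx> v"

| beta_Unit: "UnitElim C c (Star l) \<approx> c"
| beta_Zero: "NatElim C z s (Zero l) \<approx> z"
| beta_Succ: "NatElim C z s (Succ n) \<approx> inst2 s n (NatElim C z s n)"
| beta_InL: "SumElim C f g (InL A B a) \<approx> inst f a"
| beta_InR: "SumElim C f g (InR A B b) \<approx> inst g b"
| beta_Pi: "App (Lam A t) a \<approx> inst t a"
| eta_Pi: "Lam A (App (wk 1 f) (Var 0)) \<approx> f"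
| beta_Sig: "SigElim C f (MkPair A B a b) \<approx> inst2 f a b"
| beta_Id: "J C c (Refl A a) \<approx> c"

| cong_EmptyElim: "C \<approx> C' \<Longrightarrow> t \<approx> t' \<Longrightarrow> EmptyElim C t \<approx> EmptyElim C' t'"
| cong_UnitElim: "C \<approx> C' \<Longrightarrow> c \<approx> c' \<Longrightarrow> t \<approx> t' \<Longrightarrow> UnitElim C c t \<approx> UnitElim C' c' t'"
| cong_Succ: "n \<approx> n' \<Longrightarrow> Succ n \<approx> Succ n'"
| cong_NatElim: "C \<approx> C' \<Longrightarrow> z \<approx> z' \<Longrightarrow> s \<approx> s' \<Longrightarrow> n \<approx> n' \<Longrightarrow> NatElim C z s n \<approx> NatElim C' z' s' n'"
| cong_Sum: "A \<approx> A' \<Longrightarrow> B \<approx> B' \<Longrightarrow> TSum A B \<approx> TSum A' B'"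
| cong_InL: "A \<approx> A' \<Longrightarrow> B \<approx> B' \<Longrightarrow> a \<approx> a' \<Longrightarrow> InL A B a \<approx> InL A' B' a'"
| cong_InR: "A \<approx> A' \<Longrightarrow> B \<approx> B' \<Longrightarrow> b \<approx> b' \<Longrightarrow> InR A B b \<approx> InR A' B' b'"
| cong_SumElim: "C \<approx> C' \<Longrightarrow> f \<approx> f' \<Longrightarrow> g \<approx> g' \<Longrightarrow> t \<approx> t' \<Longrightarrow> SumElim C f g t \<approx> SumElim C' f' g' t'"
| cong_Pi: "A \<approx> A' \<Longrightarrow> B \<approx> B' \<Longrightarrow> TPi A B \<approx> TPi A' B'"
| cong_Lam: "A \<approx> A' \<Longrightarrow> t \<approx> t' \<Longrightarrow> Lam A t \<approx> Lam A' t'"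
| cong_App: "f \<approx> f' \<Longrightarrow> a \<approx> a' \<Longrightarrow> App f a \<approx> App f' a'"
| cong_Sig: "A \<approx> A' \<Longrightarrow> B \<approx> B' \<Longrightarrow> TSig A B \<approx> TSig A' B'"
| cong_MkPair: "A \<approx> A' \<Longrightarrow> B \<approx> B' \<Longrightarrow> a \<approx> a' \<Longrightarrow> b \<approx> b' \<Longrightarrow> MkPair A B a b \<approx> MkPair A' B' a' b'"
| cong_SigElim: "C \<approx> C' \<Longrightarrow> f \<approx> f' \<Longrightarrow> p \<approx> p' \<Longrightarrow> SigElim C f p \<approx> SigElim C' f' p'"
| cong_Id: "A \<approx> A' \<Longrightarrow> a \<approx> a' \<Longrightarrow> b \<approx> b' \<Longrightarrow> TId A a b \<approx> TId A' a' b'"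
| cong_Refl: "A \<approx> A' \<Longrightarrow> a \<approx> a' \<Longrightarrow> Refl A a \<approx> Refl A' a'"
| cong_J: "C \<approx> C' \<Longrightarrow> c \<approx> c' \<Longrightarrow> p \<approx> p' \<Longrightarrow> J C c p \<approx> J C' c' p'"
| cong_Trunc: "A \<approx> A' \<Longrightarrow> TTrunc A \<approx> TTrunc A'"
| cong_TrIn: "A \<approx> A' \<Longrightarrow> a \<approx> a' \<Longrightarrow> TrIn A a \<approx> TrIn A' a'"
| cong_TrProp: "A \<approx> A' \<Longrightarrow> TrProp A \<approx> TrProp A'"
| cong_TrRec: "A \<approx> A' \<Longrightarrow> P \<approx> P' \<Longrightarrow> TrRec A P \<approx> TrRec A' P'"


section \<open>Derived type formers\<close>

text \<open>
  A map \<open>f\<close> between types \<open>X\<close> and \<open>Y\<close> is a term of type \<open>arr X Y\<close>. All arguments of the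
  following operations live in the same context.
\<close>

definition arr :: "'l tm \<Rightarrow> 'l tm \<Rightarrow> 'l tm" where
  "arr A B = TPi A (wk 1 B)"

definition prod_ty :: "'l tm \<Rightarrow> 'l tm \<Rightarrow> 'l tm" where
  "prod_ty A B = TSig A (wk 1 B)"

definition iff_ty :: "'l tm \<Rightarrow> 'l tm \<Rightarrow> 'l tm" where
  "iff_ty A B = prod_ty (arr A B) (arr B A)"

text \<open>First projection of a term \<open>p\<close> of a \<open>\<Sigma>\<close>-type with base \<open>A\<close>.\<close>

definition fst_tm :: "'l tm \<Rightarrow> 'l tm \<Rightarrow> 'l tm" where
  "fst_tm A p = SigElim (wk 1 A) (Var 1) p"

definition id_tm :: "'l tm \<Rightarrow> 'l tm" where
  "id_tm X = Lam X (Var 0)"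

text \<open>The composite \<open>g \<circ> f\<close>, for \<open>f\<close> with domain \<open>X\<close>.\<close>

definition comp_tm :: "'l tm \<Rightarrow> 'l tm \<Rightarrow> 'l tm \<Rightarrow> 'l tm" where
  "comp_tm X g f = Lam X (App (wk 1 g) (App (wk 1 f) (Var 0)))"

text \<open>Pointwise equality of maps \<open>f\<close>, \<open>g\<close> from \<open>X\<close> to \<open>Y\<close>.\<close>

definition homotopic :: "'l tm \<Rightarrow> 'l tm \<Rightarrow> 'l tm \<Rightarrow> 'l tm \<Rightarrow> 'l tm" where
  "homotopic X Y f g = TPi X (TId (wk 1 Y) (App (wk 1 f) (Var 0)) (App (wk 1 g) (Var 0)))"

definition is_subsingleton :: "'l tm \<Rightarrow> 'l tm" where
  "is_subsingleton X = TPi X (TPi (wk 1 X) (TId (wk 2 X) (Var 1) (Var 0)))"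

definition is_contr :: "'l tm \<Rightarrow> 'l tm" where
  "is_contr X = TSig X (TPi (wk 1 X) (TId (wk 2 X) (Var 1) (Var 0)))"

definition fiber :: "'l tm \<Rightarrow> 'l tm \<Rightarrow> 'l tm \<Rightarrow> 'l tm \<Rightarrow> 'l tm" where
  "fiber X Y f y = TSig X (TId (wk 1 Y) (App (wk 1 f) (Var 0)) (wk 1 y))"

definition is_embedding :: "'l tm \<Rightarrow> 'l tm \<Rightarrow> 'l tm \<Rightarrow> 'l tm" where
  "is_embedding X Y f = TPi Y (is_subsingleton (fiber (wk 1 X) (wk 1 Y) (wk 1 f) (Var 0)))"

definition embedding_ty :: "'l tm \<Rightarrow> 'l tm \<Rightarrow> 'l tm" where
  "embedding_ty X Y = TSig (arr X Y) (is_embedding (wk 1 X) (wk 1 Y) (Var 0))"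

definition is_equiv :: "'l tm \<Rightarrow> 'l tm \<Rightarrow> 'l tm \<Rightarrow> 'l tm" where
  "is_equiv X Y f = TPi Y (is_contr (fiber (wk 1 X) (wk 1 Y) (wk 1 f) (Var 0)))"

definition equiv_ty :: "'l tm \<Rightarrow> 'l tm \<Rightarrow> 'l tm" where
  "equiv_ty X Y = TSig (arr X Y) (is_equiv (wk 1 X) (wk 1 Y) (Var 0))"


section \<open>Univalence\<close>

text \<open>
  The identity map is an equivalence: the fiber over \<open>y\<close> has centre \<open>(y, refl y)\<close>, and path
  induction on \<open>p : id x = y\<close> (generalizing \<open>y\<close> and \<open>p\<close>) identifies it with \<open>(x, p)\<close>.
\<close>

definition id_fiber :: "'l tm \<Rightarrow> 'l tm \<Rightarrow> 'l tm" where
  "id_fiber X y = fiber X X (id_tm X) y"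

definition id_fiber_pair :: "'l tm \<Rightarrow> 'l tm \<Rightarrow> 'l tm \<Rightarrow> 'l tm \<Rightarrow> 'l tm" where
  "id_fiber_pair X y x p =
     MkPair X (TId (wk 1 X) (App (wk 1 (id_tm X)) (Var 0)) (wk 1 y)) x p"

definition id_fiber_centre :: "'l tm \<Rightarrow> 'l tm \<Rightarrow> 'l tm" where
  "id_fiber_centre X y = id_fiber_pair X y y (Refl X y)"

definition id_is_equiv :: "'l tm \<Rightarrow> 'l tm" where
  "id_is_equiv X =
     Lam X
       (MkPair (id_fiber (wk 1 X) (Var 0))
         (TPi (wk 1 (id_fiber (wk 1 X) (Var 0)))
           (TId (wk 2 (id_fiber (wk 1 X) (Var 0))) (Var 1) (Var 0)))
         (id_fiber_centre (wk 1 X) (Var 0))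
         (Lam (id_fiber (wk 1 X) (Var 0))
           (SigElim
             (TId (id_fiber (wk 3 X) (Var 2)) (id_fiber_centre (wk 3 X) (Var 2)) (Var 0))
             (J (TId (id_fiber (wk 6 X) (Var 1)) (id_fiber_centre (wk 6 X) (Var 1))
                   (id_fiber_pair (wk 6 X) (Var 1) (Var 3) (Var 0)))
                (Refl (id_fiber (wk 4 X) (Var 1)) (id_fiber_centre (wk 4 X) (Var 1)))
                (Var 0))
             (Var 0))))"

definition id_equiv :: "'l tm \<Rightarrow> 'l tm" where
  "id_equiv X =
     MkPair (arr X X) (is_equiv (wk 1 X) (wk 1 X) (Var 0)) (id_tm X) (id_is_equiv X)"

text \<open>The map from identifications to equivalences, sending \<open>refl\<close> to the identity equivalence.\<close>

definition id_to_equiv :: "'l \<Rightarrow> 'l tm \<Rightarrow> 'l tm \<Rightarrow> 'l tm" where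
  "id_to_equiv l X Y =
     Lam (TId (TUniv l) X Y) (J (equiv_ty (wk 3 X) (Var 1)) (id_equiv (wk 1 X)) (Var 0))"

definition is_univalent :: "'l \<Rightarrow> 'l tm" where
  "is_univalent l =
     TPi (TUniv l) (TPi (TUniv l)
       (is_equiv (TId (TUniv l) (Var 1) (Var 0)) (equiv_ty (Var 1) (Var 0))
         (id_to_equiv l (Var 1) (Var 0))))"


section \<open>Typing\<close>

text \<open>
  The head of a context is the type of variable 0. There is no separate judgement for types: every
  type is an element of some universe.
\<close>

inductive
  wf_ctx :: "'l::universe_level tm list \<Rightarrow> bool"  ("\<turnstile> _" [51] 50) and
  has_type :: "'l::universe_level tm list \<Rightarrow> 'l tm \<Rightarrow> 'l tm \<Rightarrow> bool"
    ("_ \<turnstile> _ \<^bold>: _" [51, 51, 51] 50)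
where
  wf_Nil: "\<turnstile> []"
| wf_Cons: "\<turnstile> \<Gamma> \<Longrightarrow> \<Gamma> \<turnstile> A \<^bold>: TUniv l \<Longrightarrow> \<turnstile> A # \<Gamma>"

| ty_Var: "\<turnstile> \<Gamma> \<Longrightarrow> i < length \<Gamma> \<Longrightarrow> \<Gamma> \<turnstile> Var i \<^bold>: wk (Suc i) (\<Gamma> ! i)"
| ty_conv: "\<Gamma> \<turnstile> t \<^bold>: A \<Longrightarrow> \<Gamma> \<turnstile> A \<^bold>: TUniv l \<Longrightarrow> \<Gamma> \<turnstile> B \<^bold>: TUniv l \<Longrightarrow> A \<approx> B \<Longrightarrow> \<Gamma> \<turnstile> t \<^bold>: B"

| ty_Univ: "\<turnstile> \<Gamma> \<Longrightarrow> \<Gamma> \<turnstile> TUniv l \<^bold>: TUniv (lsuc l)"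

| ty_Empty: "\<turnstile> \<Gamma> \<Longrightarrow> \<Gamma> \<turnstile> TEmpty l \<^bold>: TUniv l"
| ty_EmptyElim: "TEmpty l # \<Gamma> \<turnstile> C \<^bold>: TUniv m \<Longrightarrow> \<Gamma> \<turnstile> t \<^bold>: TEmpty l \<Longrightarrow>
    \<Gamma> \<turnstile> EmptyElim C t \<^bold>: inst C t"

| ty_Unit: "\<turnstile> \<Gamma> \<Longrightarrow> \<Gamma> \<turnstile> TUnit l \<^bold>: TUniv l"
| ty_Star: "\<turnstile> \<Gamma> \<Longrightarrow> \<Gamma> \<turnstile> Star l \<^bold>: TUnit l"
| ty_UnitElim: "TUnit l # \<Gamma> \<turnstile> C \<^bold>: TUniv m \<Longrightarrow> \<Gamma> \<turnstile> c \<^bold>: inst C (Star l) \<Longrightarrow> \<Gamma> \<turnstile> t \<^bold>: TUnit l \<Longrightarrow>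
    \<Gamma> \<turnstile> UnitElim C c t \<^bold>: inst C t"

| ty_Nat: "\<turnstile> \<Gamma> \<Longrightarrow> \<Gamma> \<turnstile> TNat l \<^bold>: TUniv l"
| ty_Zero: "\<turnstile> \<Gamma> \<Longrightarrow> \<Gamma> \<turnstile> Zero l \<^bold>: TNat l"
| ty_Succ: "\<Gamma> \<turnstile> n \<^bold>: TNat l \<Longrightarrow> \<Gamma> \<turnstile> Succ n \<^bold>: TNat l"
| ty_NatElim: "TNat l # \<Gamma> \<turnstile> C \<^bold>: TUniv m \<Longrightarrow> \<Gamma> \<turnstile> z \<^bold>: inst C (Zero l) \<Longrightarrow>
    C # TNat l # \<Gamma> \<turnstile> s \<^bold>: inst_under 2 C (Succ (Var 1)) \<Longrightarrow> \<Gamma> \<turnstile> n \<^bold>: TNat l \<Longrightarrow>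
    \<Gamma> \<turnstile> NatElim C z s n \<^bold>: inst C n"

| ty_Sum: "\<Gamma> \<turnstile> A \<^bold>: TUniv l \<Longrightarrow> \<Gamma> \<turnstile> B \<^bold>: TUniv m \<Longrightarrow> \<Gamma> \<turnstile> TSum A B \<^bold>: TUniv (sup l m)"
| ty_InL: "\<Gamma> \<turnstile> A \<^bold>: TUniv l \<Longrightarrow> \<Gamma> \<turnstile> B \<^bold>: TUniv m \<Longrightarrow> \<Gamma> \<turnstile> a \<^bold>: A \<Longrightarrow> \<Gamma> \<turnstile> InL A B a \<^bold>: TSum A B"
| ty_InR: "\<Gamma> \<turnstile> A \<^bold>: TUniv l \<Longrightarrow> \<Gamma> \<turnstile> B \<^bold>: TUniv m \<Longrightarrow> \<Gamma> \<turnstile> b \<^bold>: B \<Longrightarrow> \<Gamma> \<turnstile> InR A B b \<^bold>: TSum A B"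
| ty_SumElim: "TSum A B # \<Gamma> \<turnstile> C \<^bold>: TUniv m \<Longrightarrow>
    A # \<Gamma> \<turnstile> f \<^bold>: inst_under 1 C (InL (wk 1 A) (wk 1 B) (Var 0)) \<Longrightarrow>
    B # \<Gamma> \<turnstile> g \<^bold>: inst_under 1 C (InR (wk 1 A) (wk 1 B) (Var 0)) \<Longrightarrow>
    \<Gamma> \<turnstile> t \<^bold>: TSum A B \<Longrightarrow> \<Gamma> \<turnstile> SumElim C f g t \<^bold>: inst C t"

| ty_Pi: "\<Gamma> \<turnstile> A \<^bold>: TUniv l \<Longrightarrow> A # \<Gamma> \<turnstile> B \<^bold>: TUniv m \<Longrightarrow> \<Gamma> \<turnstile> TPi A B \<^bold>: TUniv (sup l m)"
| ty_Lam: "\<Gamma> \<turnstile> A \<^bold>: TUniv l \<Longrightarrow> A # \<Gamma> \<turnstile> t \<^bold>: B \<Longrightarrow> \<Gamma> \<turnstile> Lam A t \<^bold>: TPi A B"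
| ty_App: "\<Gamma> \<turnstile> f \<^bold>: TPi A B \<Longrightarrow> \<Gamma> \<turnstile> a \<^bold>: A \<Longrightarrow> \<Gamma> \<turnstile> App f a \<^bold>: inst B a"

| ty_Sig: "\<Gamma> \<turnstile> A \<^bold>: TUniv l \<Longrightarrow> A # \<Gamma> \<turnstile> B \<^bold>: TUniv m \<Longrightarrow> \<Gamma> \<turnstile> TSig A B \<^bold>: TUniv (sup l m)"
| ty_MkPair: "\<Gamma> \<turnstile> A \<^bold>: TUniv l \<Longrightarrow> A # \<Gamma> \<turnstile> B \<^bold>: TUniv m \<Longrightarrow> \<Gamma> \<turnstile> a \<^bold>: A \<Longrightarrow> \<Gamma> \<turnstile> b \<^bold>: inst B a \<Longrightarrow>
    \<Gamma> \<turnstile> MkPair A B a b \<^bold>: TSig A B"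
| ty_SigElim: "TSig A B # \<Gamma> \<turnstile> C \<^bold>: TUniv m \<Longrightarrow>
    B # A # \<Gamma> \<turnstile> f \<^bold>: inst_under 2 C
      (MkPair (wk 2 A) (ren (up_ren (\<lambda>i. i + 2)) B) (Var 1) (Var 0)) \<Longrightarrow>
    \<Gamma> \<turnstile> p \<^bold>: TSig A B \<Longrightarrow> \<Gamma> \<turnstile> SigElim C f p \<^bold>: inst C p"

| ty_Id: "\<Gamma> \<turnstile> A \<^bold>: TUniv l \<Longrightarrow> \<Gamma> \<turnstile> a \<^bold>: A \<Longrightarrow> \<Gamma> \<turnstile> b \<^bold>: A \<Longrightarrow> \<Gamma> \<turnstile> TId A a b \<^bold>: TUniv l"
| ty_Refl: "\<Gamma> \<turnstile> A \<^bold>: TUniv l \<Longrightarrow> \<Gamma> \<turnstile> a \<^bold>: A \<Longrightarrow> \<Gamma> \<turnstile> Refl A a \<^bold>: TId A a a"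
| ty_J: "TId (wk 1 A) (wk 1 a) (Var 0) # A # \<Gamma> \<turnstile> C \<^bold>: TUniv m \<Longrightarrow>
    \<Gamma> \<turnstile> c \<^bold>: inst2 C a (Refl A a) \<Longrightarrow> \<Gamma> \<turnstile> p \<^bold>: TId A a b \<Longrightarrow> \<Gamma> \<turnstile> J C c p \<^bold>: inst2 C b p"

| ty_Trunc: "\<Gamma> \<turnstile> A \<^bold>: TUniv l \<Longrightarrow> \<Gamma> \<turnstile> TTrunc A \<^bold>: TUniv l"
| ty_TrIn: "\<Gamma> \<turnstile> A \<^bold>: TUniv l \<Longrightarrow> \<Gamma> \<turnstile> a \<^bold>: A \<Longrightarrow> \<Gamma> \<turnstile> TrIn A a \<^bold>: TTrunc A"
| ty_TrProp: "\<Gamma> \<turnstile> A \<^bold>: TUniv l \<Longrightarrow> \<Gamma> \<turnstile> TrProp A \<^bold>: is_subsingleton (TTrunc A)"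
| ty_TrRec: "\<Gamma> \<turnstile> A \<^bold>: TUniv l \<Longrightarrow> \<Gamma> \<turnstile> P \<^bold>: TUniv m \<Longrightarrow>
    \<Gamma> \<turnstile> TrRec A P \<^bold>: arr (is_subsingleton P) (arr (arr A P) (arr (TTrunc A) P))"

| ty_Univalence: "\<turnstile> \<Gamma> \<Longrightarrow> \<Gamma> \<turnstile> Univalence l \<^bold>: is_univalent l"


section \<open>Injectivity and resizing\<close>

text \<open>
  \<open>extension_ty X Y D j f\<close> is \<open>\<Sigma>(g : Y \<rightarrow> D), g \<circ> j \<sim> f\<close>, for \<open>j : embedding_ty X Y\<close> and
  \<open>f : arr X D\<close>. In the definitions after it, the variables \<open>Var 3\<close>, \<open>Var 2\<close>, \<open>Var 1\<close>,
  \<open>Var 0\<close> under the four quantifiers are \<open>X\<close>, \<open>Y\<close>, \<open>j\<close>, \<open>f\<close>.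
\<close>

definition extension_ty :: "'l tm \<Rightarrow> 'l tm \<Rightarrow> 'l tm \<Rightarrow> 'l tm \<Rightarrow> 'l tm \<Rightarrow> 'l tm" where
  "extension_ty X Y D j f =
     TSig (arr Y D)
       (homotopic (wk 1 X) (wk 1 D)
         (comp_tm (wk 1 X) (Var 0) (wk 1 (fst_tm (arr X Y) j))) (wk 1 f))"

definition injective_ty :: "'l \<Rightarrow> 'l \<Rightarrow> 'l tm \<Rightarrow> 'l tm" where
  "injective_ty u v D =
     TPi (TUniv u) (TPi (TUniv v) (TPi (embedding_ty (Var 1) (Var 0)) (TPi (arr (Var 2) (wk 3 D))
       (TTrunc (extension_ty (Var 3) (Var 2) (wk 4 D) (Var 1) (Var 0))))))"

definition alg_injective_ty :: "'l \<Rightarrow> 'l \<Rightarrow> 'l tm \<Rightarrow> 'l tm" where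
  "alg_injective_ty u v D =
     TPi (TUniv u) (TPi (TUniv v) (TPi (embedding_ty (Var 1) (Var 0)) (TPi (arr (Var 2) (wk 3 D))
       (extension_ty (Var 3) (Var 2) (wk 4 D) (Var 1) (Var 0)))))"

definition Omega :: "'l \<Rightarrow> 'l tm" where
  "Omega l = TSig (TUniv l) (is_subsingleton (Var 0))"

definition Omega_resizing :: "'l \<Rightarrow> 'l tm" where
  "Omega_resizing l = TSig (TUniv l) (equiv_ty (Var 0) (wk 1 (Omega l)))"

end

theory Submission
  imports Defs
begin

text \<open>
  An algebraic injectivity structure merely gives each of the required extensions, which is one
  direction. For the other, resizing gives a small type \<open>Q\<close> of codes of propositions, so the
  partial map classifier \<open>\<Sigma>(p : Q), (El p \<rightarrow> D)\<close> of \<open>D\<close> lives in the same universe as \<open>D\<close>. The map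
  that sends \<open>x\<close> to the total element with value \<open>x\<close> is an embedding, because its fiber over
  \<open>(p, \<phi>)\<close> is a retract of the proposition \<open>El p\<close>. Injectivity of \<open>D\<close> therefore yields, merely, a
  retraction \<open>r\<close> of this embedding. Given \<open>r\<close>, a map \<open>f : X \<rightarrow> D\<close> extends along an embedding
  \<open>j : X \<rightarrow> Y\<close> by sending \<open>y\<close> to the value of \<open>r\<close> at the fiber of \<open>j\<close> over \<open>y\<close> with the partial
  element \<open>f \<circ> fst\<close>: over \<open>y = j x\<close> the fiber is inhabited, so by propositional and function
  extensionality this partial element is total with value \<open>f x\<close>. Function extensionality is
  derived from univalence.

  Typing derivations are found by evaluating a type checker that is proved sound. It runs on the
  concrete levels 0, 1, 2, ..., and the resulting judgement is mapped to the levels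
  \<open>T\<close>, \<open>lsuc T\<close>, \<open>lsuc (lsuc T)\<close>, ... .
\<close>

subsection \<open>A type checker\<close>

definition dest_Univ :: "'l tm \<Rightarrow> 'l option" where
  "dest_Univ t = (case t of TUniv l \<Rightarrow> Some l | _ \<Rightarrow> None)"

definition dest_Unit :: "'l tm \<Rightarrow> 'l option" where
  "dest_Unit t = (case t of TUnit l \<Rightarrow> Some l | _ \<Rightarrow> None)"

definition is_Star :: "'l tm \<Rightarrow> bool" where
  "is_Star t = (case t of Star l \<Rightarrow> True | _ \<Rightarrow> False)"

definition is_Refl :: "'l tm \<Rightarrow> bool" where
  "is_Refl t = (case t of Refl A a \<Rightarrow> True | _ \<Rightarrow> False)"

definition dest_Pi :: "'l tm \<Rightarrow> ('l tm \<times> 'l tm) option" where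
  "dest_Pi t = (case t of TPi A B \<Rightarrow> Some (A, B) | _ \<Rightarrow> None)"

definition dest_Sig :: "'l tm \<Rightarrow> ('l tm \<times> 'l tm) option" where
  "dest_Sig t = (case t of TSig A B \<Rightarrow> Some (A, B) | _ \<Rightarrow> None)"

definition dest_Id :: "'l tm \<Rightarrow> ('l tm \<times> 'l tm \<times> 'l tm) option" where
  "dest_Id t = (case t of TId A a b \<Rightarrow> Some (A, a, b) | _ \<Rightarrow> None)"

definition dest_Lam :: "'l tm \<Rightarrow> 'l tm option" where
  "dest_Lam t = (case t of Lam A b \<Rightarrow> Some b | _ \<Rightarrow> None)"

definition dest_Pair :: "'l tm \<Rightarrow> ('l tm \<times> 'l tm) option" where
  "dest_Pair t = (case t of MkPair A B a b \<Rightarrow> Some (a, b) | _ \<Rightarrow> None)"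

text \<open>
  In the checker the first argument is fuel bounding the depth of recursion. Normalization without
  fuel returns its input; this is harmless, because only convertibility to the input is claimed.
\<close>

fun whnf :: "nat \<Rightarrow> 'l tm \<Rightarrow> 'l tm" where
  "whnf (Suc n) (App f a) =
     (let f' = whnf n f in
      case dest_Lam f' of Some t \<Rightarrow> whnf n (inst t a) | None \<Rightarrow> App f' a)"
| "whnf (Suc n) (SigElim C f p) =
     (let p' = whnf n p in
      case dest_Pair p' of Some (a, b) \<Rightarrow> whnf n (inst2 f a b) | None \<Rightarrow> SigElim C f p')"
| "whnf (Suc n) (J C c p) =
     (let p' = whnf n p in if is_Refl p' then whnf n c else J C c p')"
| "whnf (Suc n) (UnitElim C c p) =
     (let p' = whnf n p in if is_Star p' then whnf n c else UnitElim C c p')"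
| "whnf n t = t"

text \<open>Unlisted constructors stay as they are: \<open>nf\<close> then normalizes less, but each
  step remains a conversion.\<close>

fun map_args :: "('l tm \<Rightarrow> 'l tm) \<Rightarrow> 'l tm \<Rightarrow> 'l tm" where
  "map_args g (UnitElim C c t) = UnitElim (g C) (g c) (g t)"
| "map_args g (TPi A B) = TPi (g A) (g B)"
| "map_args g (Lam A t) = Lam (g A) (g t)"
| "map_args g (App f a) = App (g f) (g a)"
| "map_args g (TSig A B) = TSig (g A) (g B)"
| "map_args g (MkPair A B a b) = MkPair (g A) (g B) (g a) (g b)"
| "map_args g (SigElim C f p) = SigElim (g C) (g f) (g p)"
| "map_args g (TId A a b) = TId (g A) (g a) (g b)"
| "map_args g (Refl A a) = Refl (g A) (g a)"
| "map_args g (J C c p) = J (g C) (g c) (g p)"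
| "map_args g (TTrunc A) = TTrunc (g A)"
| "map_args g (TrIn A a) = TrIn (g A) (g a)"
| "map_args g (TrProp A) = TrProp (g A)"
| "map_args g (TrRec A P) = TrRec (g A) (g P)"
| "map_args g t = t"

text \<open>As \<open>i - 1\<close> sends 0 to 0, the test \<open>wk 1 f' = f\<close> succeeds
  exactly when variable 0 is not free in \<open>f\<close>.\<close>

fun eta :: "'l tm \<Rightarrow> 'l tm" where
  "eta (Lam A (App f (Var 0))) =
     (let f' = ren (\<lambda>i. i - 1) f in
      if wk 1 f' = f then f' else Lam A (App f (Var 0)))"
| "eta t = t"

primrec nf :: "nat \<Rightarrow> 'l tm \<Rightarrow> 'l tm" where
  "nf 0 t = t"
| "nf (Suc n) t = eta (map_args (nf n) (whnf n t))"

type_synonym 'l inference = "'l tm list \<Rightarrow> 'l tm \<Rightarrow> 'l tm option"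

definition sort_of :: "'l inference \<Rightarrow> 'l tm list \<Rightarrow> 'l tm \<Rightarrow> 'l option" where
  "sort_of I \<Gamma> A = Option.bind (I \<Gamma> A) dest_Univ"

text \<open>Equal sorts are demanded because \<open>ty_conv\<close> wants both types in one
  universe.\<close>

definition same_ty :: "nat \<Rightarrow> 'l inference \<Rightarrow> 'l tm list \<Rightarrow> 'l tm \<Rightarrow> 'l tm \<Rightarrow> bool" where
  "same_ty n I \<Gamma> A B \<longleftrightarrow> A = B \<or>
     nf n A = nf n B \<and> sort_of I \<Gamma> A \<noteq> None \<and> sort_of I \<Gamma> A = sort_of I \<Gamma> B"

definition checks :: "nat \<Rightarrow> 'l inference \<Rightarrow> 'l tm list \<Rightarrow> 'l tm \<Rightarrow> 'l tm \<Rightarrow> bool" where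
  "checks n I \<Gamma> t A \<longleftrightarrow> (case I \<Gamma> t of None \<Rightarrow> False | Some A' \<Rightarrow> same_ty n I \<Gamma> A' A)"

definition infer_head :: "nat \<Rightarrow> 'l inference \<Rightarrow> 'l tm list \<Rightarrow> 'l tm \<Rightarrow> 'l tm option" where
  "infer_head n I \<Gamma> t = (case I \<Gamma> t of None \<Rightarrow> None | Some A \<Rightarrow>
     (let A' = whnf n A in if same_ty n I \<Gamma> A A' then Some A' else None))"

text \<open>
  Whenever a type is replaced by a convertible one, the sorts of both types are inferred again.
  This is wasteful, but it supplies the premises of the conversion rule directly, so that neither
  subject reduction nor uniqueness of types has to be proved.
\<close>

fun infer :: "nat \<Rightarrow> 'l::universe_level inference" where
  "infer (Suc n) \<Gamma> (Var i) = (if i < length \<Gamma> then Some (wk (Suc i) (\<Gamma> ! i)) else None)"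
| "infer (Suc n) \<Gamma> (TUniv l) = Some (TUniv (lsuc l))"
| "infer (Suc n) \<Gamma> (TUnit l) = Some (TUniv l)"
| "infer (Suc n) \<Gamma> (Star l) = Some (TUnit l)"
| "infer (Suc n) \<Gamma> (UnitElim C c t) =
     (case Option.bind (infer_head n (infer n) \<Gamma> t) dest_Unit of None \<Rightarrow> None | Some l \<Rightarrow>
      if sort_of (infer n) (TUnit l # \<Gamma>) C \<noteq> None \<and> checks n (infer n) \<Gamma> c (inst C (Star l))
      then Some (inst C t) else None)"
| "infer (Suc n) \<Gamma> (TPi A B) =
     (case sort_of (infer n) \<Gamma> A of None \<Rightarrow> None | Some l \<Rightarrow>
      (case sort_of (infer n) (A # \<Gamma>) B of None \<Rightarrow> None | Some m \<Rightarrow> Some (TUniv (sup l m))))"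
| "infer (Suc n) \<Gamma> (Lam A t) =
     (if sort_of (infer n) \<Gamma> A = None then None
      else case infer n (A # \<Gamma>) t of None \<Rightarrow> None | Some B \<Rightarrow> Some (TPi A B))"
| "infer (Suc n) \<Gamma> (App f a) =
     (case Option.bind (infer_head n (infer n) \<Gamma> f) dest_Pi of None \<Rightarrow> None | Some (A, B) \<Rightarrow>
      if checks n (infer n) \<Gamma> a A then Some (inst B a) else None)"
| "infer (Suc n) \<Gamma> (TSig A B) =
     (case sort_of (infer n) \<Gamma> A of None \<Rightarrow> None | Some l \<Rightarrow>
      (case sort_of (infer n) (A # \<Gamma>) B of None \<Rightarrow> None | Some m \<Rightarrow> Some (TUniv (sup l m))))"
| "infer (Suc n) \<Gamma> (MkPair A B a b) =
     (if sort_of (infer n) \<Gamma> A \<noteq> None \<and> sort_of (infer n) (A # \<Gamma>) B \<noteq> None \<and>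
         checks n (infer n) \<Gamma> a A \<and> checks n (infer n) \<Gamma> b (inst B a)
      then Some (TSig A B) else None)"
| "infer (Suc n) \<Gamma> (SigElim C f p) =
     (case Option.bind (infer_head n (infer n) \<Gamma> p) dest_Sig of None \<Rightarrow> None | Some (A, B) \<Rightarrow>
      if sort_of (infer n) \<Gamma> A \<noteq> None \<and> sort_of (infer n) (A # \<Gamma>) B \<noteq> None \<and>
         sort_of (infer n) (TSig A B # \<Gamma>) C \<noteq> None \<and>
         checks n (infer n) (B # A # \<Gamma>) f (inst_under 2 C
           (MkPair (wk 2 A) (ren (up_ren (\<lambda>i. i + 2)) B) (Var 1) (Var 0)))
      then Some (inst C p) else None)"
| "infer (Suc n) \<Gamma> (TId A a b) =
     (case sort_of (infer n) \<Gamma> A of None \<Rightarrow> None | Some l \<Rightarrow>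
      if checks n (infer n) \<Gamma> a A \<and> checks n (infer n) \<Gamma> b A then Some (TUniv l) else None)"
| "infer (Suc n) \<Gamma> (Refl A a) =
     (if sort_of (infer n) \<Gamma> A \<noteq> None \<and> checks n (infer n) \<Gamma> a A
      then Some (TId A a a) else None)"
| "infer (Suc n) \<Gamma> (J C c p) =
     (case Option.bind (infer_head n (infer n) \<Gamma> p) dest_Id of None \<Rightarrow> None | Some (A, a, b) \<Rightarrow>
      if sort_of (infer n) \<Gamma> A \<noteq> None \<and>
         sort_of (infer n) (A # \<Gamma>) (TId (wk 1 A) (wk 1 a) (Var 0)) \<noteq> None \<and>
         sort_of (infer n) (TId (wk 1 A) (wk 1 a) (Var 0) # A # \<Gamma>) C \<noteq> None \<and>
         checks n (infer n) \<Gamma> c (inst2 C a (Refl A a))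
      then Some (inst2 C b p) else None)"
| "infer (Suc n) \<Gamma> (TTrunc A) = map_option TUniv (sort_of (infer n) \<Gamma> A)"
| "infer (Suc n) \<Gamma> (TrIn A a) =
     (if sort_of (infer n) \<Gamma> A \<noteq> None \<and> checks n (infer n) \<Gamma> a A
      then Some (TTrunc A) else None)"
| "infer (Suc n) \<Gamma> (TrProp A) =
     (if sort_of (infer n) \<Gamma> A \<noteq> None then Some (is_subsingleton (TTrunc A)) else None)"
| "infer (Suc n) \<Gamma> (TrRec A P) =
     (if sort_of (infer n) \<Gamma> A \<noteq> None \<and> sort_of (infer n) \<Gamma> P \<noteq> None
      then Some (arr (is_subsingleton P) (arr (arr A P) (arr (TTrunc A) P))) else None)"
| "infer (Suc n) \<Gamma> (Univalence l) = Some (is_univalent l)"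
| "infer n \<Gamma> t = None"

subsection \<open>Soundness of the checker\<close>

lemma dest_simps [simp]:
  "dest_Univ t = Some l \<longleftrightarrow> t = TUniv l"
  "dest_Unit t = Some l \<longleftrightarrow> t = TUnit l"
  "dest_Pi t = Some P \<longleftrightarrow> t = TPi (fst P) (snd P)"
  "dest_Sig t = Some P \<longleftrightarrow> t = TSig (fst P) (snd P)"
  "dest_Id t = Some Q \<longleftrightarrow> t = TId (fst Q) (fst (snd Q)) (snd (snd Q))"
  "is_Star t \<longleftrightarrow> (\<exists>l. t = Star l)"
  "is_Refl t \<longleftrightarrow> (\<exists>A a. t = Refl A a)"
  "dest_Lam t = Some b \<longleftrightarrow> (\<exists>A. t = Lam A b)"
  "dest_Pair t = Some P \<longleftrightarrow> (\<exists>A B. t = MkPair A B (fst P) (snd P))"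
  by (auto simp: dest_Univ_def dest_Unit_def dest_Pi_def dest_Sig_def dest_Id_def is_Star_def
      is_Refl_def dest_Lam_def dest_Pair_def split: tm.splits)

declare conv_trans [trans]

lemma whnf_conv: "t \<approx> whnf n t"
proof (induction n t rule: whnf.induct)
  case (1 n f a)
  show ?case
  proof (cases "dest_Lam (whnf n f)")
    case None
    then show ?thesis using 1 by (auto simp: Let_def intro: cong_App conv_refl)
  next
    case (Some b)
    then obtain A where A: "whnf n f = Lam A b" by auto
    have "App f a \<approx> App (Lam A b) a" using 1(1) A by (auto intro: cong_App conv_refl)
    also have "\<dots> \<approx> inst b a" by (rule beta_Pi)
    also have "\<dots> \<approx> whnf n (inst b a)" using 1(2)[OF refl Some] .
    \<comment> \<open>\<open>Some\<close> must stay a rewrite rule that resolves the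
      \<open>case\<close> in \<open>whnf\<close>; \<open>dest_simps\<close> would make it
      existential.\<close>
    finally show ?thesis using Some by (simp add: Let_def del: dest_simps)
  qed
next
  case (2 n C f p)
  show ?case
  proof (cases "dest_Pair (whnf n p)")
    case None
    then show ?thesis using 2 by (auto simp: Let_def intro: cong_SigElim conv_refl)
  next
    case (Some ab)
    obtain a b where ab: "ab = (a, b)" by fastforce
    with Some obtain A B where A: "whnf n p = MkPair A B a b" by auto
    have "SigElim C f p \<approx> SigElim C f (MkPair A B a b)"
      using 2(1) A by (auto intro: cong_SigElim conv_refl)
    also have "\<dots> \<approx> inst2 f a b" by (rule beta_Sig)
    also have "\<dots> \<approx> whnf n (inst2 f a b)" using 2(2)[OF refl Some] ab by simp
    finally show ?thesis using Some ab by (simp add: Let_def del: dest_simps)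
  qed
next
  case (3 n C c p)
  show ?case
  proof (cases "is_Refl (whnf n p)")
    case False
    then show ?thesis using 3 by (auto simp: Let_def intro: cong_J conv_refl)
  next
    case True
    then obtain A a where "whnf n p = Refl A a" by auto
    then have "J C c p \<approx> J C c (Refl A a)" using 3(1) by (auto intro: cong_J conv_refl)
    also have "\<dots> \<approx> c" by (rule beta_Id)
    also have "\<dots> \<approx> whnf n c" using 3(2)[OF refl True] .
    finally show ?thesis using True by (simp add: Let_def)
  qed
next
  case (4 n C c p)
  show ?case
  proof (cases "is_Star (whnf n p)")
    case False
    then show ?thesis using 4 by (auto simp: Let_def intro: cong_UnitElim conv_refl)
  next
    case True
    then obtain l where "whnf n p = Star l" by auto
    then have "UnitElim C c p \<approx> UnitElim C c (Star l)"
      using 4(1) by (auto intro: cong_UnitElim conv_refl)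
    also have "\<dots> \<approx> c" by (rule beta_Unit)
    also have "\<dots> \<approx> whnf n c" using 4(2)[OF refl True] .
    finally show ?thesis using True by (simp add: Let_def)
  qed
qed (simp_all add: conv_refl)

lemma map_args_conv: "(\<And>t. t \<approx> g t) \<Longrightarrow> t \<approx> map_args g t"
  by (cases "(g, t)" rule: map_args.cases)
    (auto intro: conv_refl cong_UnitElim cong_Pi cong_Lam cong_App cong_Sig cong_MkPair cong_SigElim
      cong_Id cong_Refl cong_J cong_Trunc cong_TrIn cong_TrProp cong_TrRec)

lemma eta_conv: "t \<approx> eta t"
proof (cases t rule: eta.cases)
  case (1 A f)
  then show ?thesis
    using eta_Pi[of A "ren (\<lambda>i. i - 1) f"] by (auto simp: Let_def intro: conv_refl)
qed (auto intro: conv_refl)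

lemma nf_conv: "t \<approx> nf n t"
proof (induction n arbitrary: t)
  case (Suc n)
  show ?case
    unfolding nf.simps
    by (rule conv_trans[OF whnf_conv conv_trans[OF map_args_conv[OF Suc] eta_conv]])
qed (simp add: conv_refl)

text \<open>Stated for any inference function, so that the lemmas on \<open>sort_of\<close>,
  \<open>checks\<close> and \<open>infer_head\<close> apply to \<open>infer n\<close> inside the
  induction on \<open>n\<close>.\<close>

definition sound :: "'l::universe_level inference \<Rightarrow> bool" where
  "sound I \<longleftrightarrow> (\<forall>\<Gamma> t A. \<turnstile> \<Gamma> \<longrightarrow> I \<Gamma> t = Some A \<longrightarrow> (\<Gamma> \<turnstile> t \<^bold>: A))"

lemma soundD: "sound I \<Longrightarrow> \<turnstile> \<Gamma> \<Longrightarrow> I \<Gamma> t = Some A \<Longrightarrow> \<Gamma> \<turnstile> t \<^bold>: A"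
  by (simp add: sound_def)

lemma sort_of_sound: "sound I \<Longrightarrow> \<turnstile> \<Gamma> \<Longrightarrow> sort_of I \<Gamma> A = Some l \<Longrightarrow> \<Gamma> \<turnstile> A \<^bold>: TUniv l"
  by (auto simp: sort_of_def bind_eq_Some_conv dest: soundD)

lemma same_ty_sound:
  assumes "sound I" "\<turnstile> \<Gamma>" "same_ty n I \<Gamma> A B" "\<Gamma> \<turnstile> t \<^bold>: A"
  shows "\<Gamma> \<turnstile> t \<^bold>: B"
proof (cases "A = B")
  case False
  with assms(3) obtain l where l: "sort_of I \<Gamma> A = Some l" "sort_of I \<Gamma> B = Some l"
    and "nf n A = nf n B"
    by (auto simp: same_ty_def) metis
  then have "A \<approx> B" using nf_conv[of A n] nf_conv[of B n] by (metis conv_sym conv_trans)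
  then show ?thesis using assms l by (blast intro: ty_conv sort_of_sound)
qed (use assms in simp)

lemma checks_sound:
  assumes "sound I" "\<turnstile> \<Gamma>" "checks n I \<Gamma> t A"
  shows "\<Gamma> \<turnstile> t \<^bold>: A"
  using assms(3) same_ty_sound[OF assms(1,2)] soundD[OF assms(1,2)]
  by (auto simp: checks_def split: option.splits)

lemma infer_head_sound:
  assumes "sound I" "\<turnstile> \<Gamma>" "infer_head n I \<Gamma> t = Some A"
  shows "\<Gamma> \<turnstile> t \<^bold>: A"
  using assms(3) same_ty_sound[OF assms(1,2)] soundD[OF assms(1,2)]
  by (auto simp: infer_head_def Let_def split: option.splits if_splits)

lemma sound_infer: "sound (infer n :: 'l::universe_level inference)"
proof (induction n)
  case (Suc n)
  note S = sort_of_sound[OF Suc] and C = checks_sound[OF Suc] and H = infer_head_sound[OF Suc]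
  have I: "\<turnstile> \<Gamma> \<Longrightarrow> infer n \<Gamma> t = Some A \<Longrightarrow> \<Gamma> \<turnstile> t \<^bold>: A" for \<Gamma> :: "'l tm list" and t A
    using Suc by (rule soundD)
  have "\<Gamma> \<turnstile> t \<^bold>: A" if "\<turnstile> \<Gamma>" "infer (Suc n) \<Gamma> t = Some A" for \<Gamma> :: "'l tm list" and t A
  proof (cases t)
    case (UnitElim C c p)
    with that obtain l m where *: "infer_head n (infer n) \<Gamma> p = Some (TUnit l)"
      "sort_of (infer n) (TUnit l # \<Gamma>) C = Some m" "checks n (infer n) \<Gamma> c (inst C (Star l))"
      "A = inst C p"
      by (auto simp: bind_eq_Some_conv split: option.splits if_splits)
    show ?thesis
      unfolding UnitElim \<open>A = _\<close>
      by (rule ty_UnitElim[OF S[OF wf_Cons[OF that(1) ty_Unit[OF that(1)]] *(2)]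
            C[OF that(1) *(3)] H[OF that(1) *(1)]])
  next
    case (SigElim C f p)
    with that obtain A' B' l m k where *: "infer_head n (infer n) \<Gamma> p = Some (TSig A' B')"
      "sort_of (infer n) \<Gamma> A' = Some l" "sort_of (infer n) (A' # \<Gamma>) B' = Some m"
      "sort_of (infer n) (TSig A' B' # \<Gamma>) C = Some k"
      "checks n (infer n) (B' # A' # \<Gamma>) f (inst_under 2 C
           (MkPair (wk 2 A') (ren (up_ren (\<lambda>i. i + 2)) B') (Var 1) (Var 0)))" "A = inst C p"
      by (auto simp: bind_eq_Some_conv split: option.splits if_splits)
    \<comment> \<open>The sorts of \<open>A'\<close> and \<open>B'\<close> that the checker inferred
      anew make these contexts well-formed, without inversion of typing.\<close>
    have w: "\<turnstile> A' # \<Gamma>" "\<turnstile> B' # A' # \<Gamma>" "\<turnstile> TSig A' B' # \<Gamma>"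
      using * that(1) by (blast intro: wf_Cons S ty_Sig)+
    show ?thesis
      unfolding SigElim \<open>A = _\<close>
      by (rule ty_SigElim[OF S[OF w(3) *(4)] C[OF w(2) *(5)] H[OF that(1) *(1)]])
  next
    case (J C c p)
    with that obtain A' a b l m k where *: "infer_head n (infer n) \<Gamma> p = Some (TId A' a b)"
      "sort_of (infer n) \<Gamma> A' = Some l"
      "sort_of (infer n) (A' # \<Gamma>) (TId (wk 1 A') (wk 1 a) (Var 0)) = Some m"
      "sort_of (infer n) (TId (wk 1 A') (wk 1 a) (Var 0) # A' # \<Gamma>) C = Some k"
      "checks n (infer n) \<Gamma> c (inst2 C a (Refl A' a))" "A = inst2 C b p"
      by (auto simp: bind_eq_Some_conv split: option.splits if_splits)
    have w: "\<turnstile> A' # \<Gamma>" "\<turnstile> TId (wk 1 A') (wk 1 a) (Var 0) # A' # \<Gamma>"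
      using * that(1) by (blast intro: wf_Cons S)+
    show ?thesis
      unfolding J \<open>A = _\<close>
      by (rule ty_J[OF S[OF w(2) *(4)] C[OF that(1) *(5)] H[OF that(1) *(1)]])
  next
    case (App f a)
    with that show ?thesis
      by (auto simp: bind_eq_Some_conv split: option.splits if_splits dest: H C intro!: ty_App)
  next
    case (TPi X Y)
    with that show ?thesis
      by (auto split: option.splits intro!: ty_Pi[OF S S] intro: wf_Cons S)
  next
    case (TSig X Y)
    with that show ?thesis
      by (auto split: option.splits intro!: ty_Sig[OF S S] intro: wf_Cons S)
  next
    case (Lam X b)
    with that show ?thesis
      by (auto split: option.splits if_splits intro!: ty_Lam[OF S I] intro: wf_Cons S)
  next
    case (MkPair X Y a b)
    with that show ?thesis
      by (auto split: if_splits intro!: ty_MkPair[OF S S C C] intro: wf_Cons S)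
  next
    case (TTrunc X)
    with that show ?thesis by (auto intro: ty_Trunc S)
  qed (use that in \<open>auto split: option.splits if_splits intro: S C
      ty_Var ty_Univ ty_Unit ty_Star ty_Id ty_Refl ty_TrIn ty_TrProp ty_TrRec ty_Univalence\<close>)
  then show ?case by (auto simp: sound_def)
qed (simp add: sound_def)

subsection \<open>Substitution and change of levels\<close>

lemma up_ren_simps [simp]: "up_ren \<rho> 0 = 0" "up_ren \<rho> (Suc i) = Suc (\<rho> i)"
  by (simp_all add: up_ren_def)

lemma up_simps [simp]: "up \<sigma> 0 = Var 0" "up \<sigma> (Suc i) = wk 1 (\<sigma> i)"
  by (simp_all add: up_def)

lemma up_Var: "up Var = Var"
proof
  show "up Var i = Var i" for i by (cases i) (simp_all add: wk_def)
qed

lemma subst_Var: "subst Var t = t"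
  by (induction t) (simp_all add: up_Var)

lemma up_comp_up_ren: "up \<sigma> \<circ> up_ren \<rho> = up (\<sigma> \<circ> \<rho>)"
proof
  show "(up \<sigma> \<circ> up_ren \<rho>) i = up (\<sigma> \<circ> \<rho>) i" for i by (cases i) simp_all
qed

lemma subst_ren: "subst \<sigma> (ren \<rho> t) = subst (\<sigma> \<circ> \<rho>) t"
  by (induction t arbitrary: \<sigma> \<rho>) (simp_all add: up_comp_up_ren)

lemma inst_wk: "inst (wk 1 B) a = B"
  by (simp add: inst_def inst_under_def wk_def subst_ren comp_def subst_Var)

lemma map_tm_ren: "map_tm f (ren \<rho> t) = ren \<rho> (map_tm f t)"
  by (induction t arbitrary: \<rho>) simp_all

lemma map_tm_wk: "map_tm f (wk n t) = wk n (map_tm f t)"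
  by (simp add: wk_def map_tm_ren)

lemma map_tm_up: "map_tm f \<circ> up \<sigma> = up (map_tm f \<circ> \<sigma>)"
proof
  show "(map_tm f \<circ> up \<sigma>) i = up (map_tm f \<circ> \<sigma>) i" for i by (cases i) (simp_all add: map_tm_wk)
qed

lemma map_tm_subst: "map_tm f (subst \<sigma> t) = subst (map_tm f \<circ> \<sigma>) (map_tm f t)"
  by (induction t arbitrary: \<sigma>) (simp_all add: map_tm_up)

lemma map_tm_inst_under: "map_tm f (inst_under n t a) = inst_under n (map_tm f t) (map_tm f a)"
  unfolding inst_under_def map_tm_subst by (rule arg_cong[where f = "\<lambda>\<sigma>. subst \<sigma> _"])
    (auto split: nat.splits)

lemma map_tm_inst: "map_tm f (inst t a) = inst (map_tm f t) (map_tm f a)"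
  by (simp add: inst_def map_tm_inst_under)

lemma map_tm_inst2: "map_tm f (inst2 t a b) = inst2 (map_tm f t) (map_tm f a) (map_tm f b)"
  unfolding inst2_def map_tm_subst by (rule arg_cong[where f = "\<lambda>\<sigma>. subst \<sigma> _"])
    (auto split: nat.splits)

lemmas map_tm_ops = map_tm_ren map_tm_wk map_tm_inst_under map_tm_inst map_tm_inst2

lemmas derived_ty_defs = arr_def prod_ty_def iff_ty_def fst_tm_def id_tm_def comp_tm_def
  homotopic_def is_subsingleton_def is_contr_def fiber_def is_embedding_def embedding_ty_def
  is_equiv_def equiv_ty_def id_fiber_def id_fiber_pair_def id_fiber_centre_def id_is_equiv_def
  id_equiv_def id_to_equiv_def is_univalent_def extension_ty_def injective_ty_def
  alg_injective_ty_def Omega_def Omega_resizing_def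

lemma map_tm_arr: "map_tm f (arr A B) = arr (map_tm f A) (map_tm f B)"
  by (simp add: arr_def map_tm_wk)

lemma map_tm_is_subsingleton:
  "map_tm f (is_subsingleton A) = is_subsingleton (map_tm f A)"
  by (simp add: is_subsingleton_def map_tm_wk)

lemma conv_map_tm: "t \<approx> u \<Longrightarrow> map_tm f t \<approx> map_tm f u"
proof (induction rule: conv.induct)
  case (conv_trans t u v)
  then show ?case by (blast intro: conv.conv_trans)
qed (auto simp: map_tm_ops simp del: One_nat_def intro: conv.intros)

text \<open>Typing rules mention levels only through \<open>lsuc\<close> and \<open>sup\<close>, so
  relabelling along a map preserving both respects derivations.\<close>

lemma has_type_map_tm:
  fixes f :: "'k::universe_level \<Rightarrow> 'l::universe_level"
  assumes "\<And>l. f (lsuc l) = lsuc (f l)" and "\<And>l m. f (sup l m) = sup (f l) (f m)"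
  shows "\<turnstile> \<Gamma> \<Longrightarrow> \<turnstile> map (map_tm f) \<Gamma>"
    and "\<Gamma> \<turnstile> t \<^bold>: A \<Longrightarrow> map (map_tm f) \<Gamma> \<turnstile> map_tm f t \<^bold>: map_tm f A"
proof (induction rule: wf_ctx_has_type.inducts)
  case (ty_Var \<Gamma> i)
  then show ?case using wf_ctx_has_type.ty_Var[of "map (map_tm f) \<Gamma>" i] by (simp add: map_tm_wk)
next
  case (ty_conv \<Gamma> t A l B)
  then show ?case by (auto intro: wf_ctx_has_type.ty_conv conv_map_tm)
next
  case (ty_Univalence \<Gamma> l)
  then show ?case
    using wf_ctx_has_type.ty_Univalence[of "map (map_tm f) \<Gamma>" "f l"]
    by (simp add: derived_ty_defs map_tm_ops assms)
qed (auto simp: assms map_tm_ops map_tm_arr map_tm_is_subsingleton intro: wf_ctx_has_type.intros)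

definition level_from :: "'l::universe_level \<Rightarrow> nat \<Rightarrow> 'l" where
  "level_from l n = (lsuc ^^ n) l"

text \<open>Joins of \<open>nat\<close> levels are maxima, so monotonicity suffices even if the
  target order is partial.\<close>

lemma level_from_sup: "level_from l (sup m n) = sup (level_from l m) (level_from l n)"
proof -
  have "mono (level_from l)"
    unfolding mono_iff_le_Suc level_from_def using less_lsuc by (auto intro: less_imp_le)
  then show ?thesis
    by (cases "m \<le> n") (auto simp: sup_max max_def sup_absorb1 sup_absorb2 monoD)
qed

lemma level_from_simps [simp]:
  "level_from l 0 = l" "level_from l (lsuc n) = lsuc (level_from l n)"
  by (simp_all add: level_from_def lsuc_nat_def)

subsection \<open>Named terms\<close>

text \<open>
  A term over the levels 0, 1, 2, ... is represented by the function that sends the length of its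
  context to the de Bruijn term, so that binders become HOL functions. The argument \<open>k\<close> of \<open>bvar\<close>
  is a de Bruijn level.
\<close>

type_synonym hterm = "nat \<Rightarrow> nat tm"

text \<open>The index is computed from the length of the context of use, which makes weakening
  implicit.\<close>

definition bvar :: "nat \<Rightarrow> hterm" where
  "bvar k n = Var (n - Suc k)"

definition pi :: "hterm \<Rightarrow> (hterm \<Rightarrow> hterm) \<Rightarrow> hterm" where
  "pi A B n = TPi (A n) (B (bvar n) (Suc n))"

definition lam :: "hterm \<Rightarrow> (hterm \<Rightarrow> hterm) \<Rightarrow> hterm" where
  "lam A b n = Lam (A n) (b (bvar n) (Suc n))"

definition app :: "hterm \<Rightarrow> hterm \<Rightarrow> hterm"  (infixl "\<cdot>" 70) where
  "(f \<cdot> a) n = App (f n) (a n)"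

definition sig :: "hterm \<Rightarrow> (hterm \<Rightarrow> hterm) \<Rightarrow> hterm" where
  "sig A B n = TSig (A n) (B (bvar n) (Suc n))"

definition pair :: "hterm \<Rightarrow> (hterm \<Rightarrow> hterm) \<Rightarrow> hterm \<Rightarrow> hterm \<Rightarrow> hterm" where
  "pair A B a b n = MkPair (A n) (B (bvar n) (Suc n)) (a n) (b n)"

definition sig_ind :: "(hterm \<Rightarrow> hterm) \<Rightarrow> (hterm \<Rightarrow> hterm \<Rightarrow> hterm) \<Rightarrow> hterm \<Rightarrow> hterm" where
  "sig_ind C f p n = SigElim (C (bvar n) (Suc n)) (f (bvar n) (bvar (Suc n)) (Suc (Suc n))) (p n)"

text \<open>Based path induction: the left endpoint is fixed, and the motive is carried from the
  left endpoint to the right one.\<close>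

definition path_ind :: "(hterm \<Rightarrow> hterm \<Rightarrow> hterm) \<Rightarrow> hterm \<Rightarrow> hterm \<Rightarrow> hterm" where
  "path_ind C c p n = J (C (bvar n) (bvar (Suc n)) (Suc (Suc n))) (c n) (p n)"

definition unit_ind :: "(hterm \<Rightarrow> hterm) \<Rightarrow> hterm \<Rightarrow> hterm \<Rightarrow> hterm" where
  "unit_ind C c p n = UnitElim (C (bvar n) (Suc n)) (c n) (p n)"

definition univ :: hterm where "univ n = TUniv 0"
definition unit_ty :: hterm where "unit_ty n = TUnit 0"
definition star :: hterm where "star n = Star 0"
definition univalence :: hterm where "univalence n = Univalence 0"
definition omega :: hterm where "omega n = Omega 0"
definition resizing :: hterm where "resizing n = Omega_resizing 0"

definition imp :: "hterm \<Rightarrow> hterm \<Rightarrow> hterm"  (infixr "\<rightarrow>" 60) where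
  "(A \<rightarrow> B) n = arr (A n) (B n)"

definition idt :: "hterm \<Rightarrow> hterm \<Rightarrow> hterm \<Rightarrow> hterm" where
  "idt A a b n = TId (A n) (a n) (b n)"

definition rfl :: "hterm \<Rightarrow> hterm \<Rightarrow> hterm" where
  "rfl A a n = Refl (A n) (a n)"

definition trunc :: "hterm \<Rightarrow> hterm" where
  "trunc A n = TTrunc (A n)"

definition trin :: "hterm \<Rightarrow> hterm \<Rightarrow> hterm" where
  "trin A a n = TrIn (A n) (a n)"

definition trprop :: "hterm \<Rightarrow> hterm" where
  "trprop A n = TrProp (A n)"

definition trrec :: "hterm \<Rightarrow> hterm \<Rightarrow> hterm" where
  "trrec A P n = TrRec (A n) (P n)"

definition proj1 :: "hterm \<Rightarrow> hterm \<Rightarrow> hterm" where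
  "proj1 A p n = fst_tm (A n) (p n)"

definition compose :: "hterm \<Rightarrow> hterm \<Rightarrow> hterm \<Rightarrow> hterm" where
  "compose X g f n = comp_tm (X n) (g n) (f n)"

definition idfun :: "hterm \<Rightarrow> hterm" where
  "idfun X n = id_tm (X n)"

definition homot :: "hterm \<Rightarrow> hterm \<Rightarrow> hterm \<Rightarrow> hterm \<Rightarrow> hterm" where
  "homot X Y f g n = homotopic (X n) (Y n) (f n) (g n)"

definition is_prop :: "hterm \<Rightarrow> hterm" where
  "is_prop X n = is_subsingleton (X n)"

definition fibre :: "hterm \<Rightarrow> hterm \<Rightarrow> hterm \<Rightarrow> hterm \<Rightarrow> hterm" where
  "fibre X Y f y n = fiber (X n) (Y n) (f n) (y n)"

definition is_emb :: "hterm \<Rightarrow> hterm \<Rightarrow> hterm \<Rightarrow> hterm" where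
  "is_emb X Y f n = is_embedding (X n) (Y n) (f n)"

definition embedding :: "hterm \<Rightarrow> hterm \<Rightarrow> hterm" where
  "embedding X Y n = embedding_ty (X n) (Y n)"

definition is_eqv :: "hterm \<Rightarrow> hterm \<Rightarrow> hterm \<Rightarrow> hterm" where
  "is_eqv X Y f n = is_equiv (X n) (Y n) (f n)"

definition eqv :: "hterm \<Rightarrow> hterm \<Rightarrow> hterm" where
  "eqv X Y n = equiv_ty (X n) (Y n)"

definition id_eqv :: "hterm \<Rightarrow> hterm" where
  "id_eqv X n = id_equiv (X n)"

definition id_to_eqv :: "hterm \<Rightarrow> hterm \<Rightarrow> hterm" where
  "id_to_eqv X Y n = id_to_equiv 0 (X n) (Y n)"

definition extension :: "hterm \<Rightarrow> hterm \<Rightarrow> hterm \<Rightarrow> hterm \<Rightarrow> hterm \<Rightarrow> hterm" where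
  "extension X Y D j f n = extension_ty (X n) (Y n) (D n) (j n) (f n)"

definition injective :: "hterm \<Rightarrow> hterm" where
  "injective D n = injective_ty 0 0 (D n)"

definition alg_injective :: "hterm \<Rightarrow> hterm" where
  "alg_injective D n = alg_injective_ty 0 0 (D n)"

definition iff :: "hterm \<Rightarrow> hterm \<Rightarrow> hterm" where
  "iff A B n = iff_ty (A n) (B n)"

definition provable :: "hterm \<Rightarrow> bool" where
  "provable A \<longleftrightarrow> (\<exists>t. [] \<turnstile> t \<^bold>: A 0)"

text \<open>Fuel 100 suffices for all checks below; too little fuel could only make a check
  fail.\<close>

definition proves :: "hterm \<Rightarrow> hterm \<Rightarrow> bool" where
  "proves t A \<longleftrightarrow> checks 100 (infer 100) [] (t 0) (A 0)"

lemma provableI: "proves t A \<Longrightarrow> provable A"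
  unfolding proves_def provable_def using checks_sound[OF sound_infer wf_Nil] by blast

text \<open>
  A proved type enters a later proof term as a \<open>\<lambda>\<close>-bound variable, so its own proof term is never
  unfolded during normalization.
\<close>

lemma provable_mp: "provable (A \<rightarrow> B) \<Longrightarrow> provable A \<Longrightarrow> provable B"
  unfolding provable_def imp_def arr_def using ty_App[of "[]"] inst_wk by metis

definition proj2 :: "hterm \<Rightarrow> (hterm \<Rightarrow> hterm) \<Rightarrow> hterm \<Rightarrow> hterm" where
  "proj2 A B p = sig_ind (\<lambda>z. B (proj1 A z)) (\<lambda>_ b. b) p"

definition singl :: "hterm \<Rightarrow> hterm \<Rightarrow> hterm" where
  "singl A a = sig A (\<lambda>x. idt A a x)"

definition singl_pair :: "hterm \<Rightarrow> hterm \<Rightarrow> hterm \<Rightarrow> hterm \<Rightarrow> hterm" where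
  "singl_pair A a x p = pair A (\<lambda>x. idt A a x) x p"

definition fib_pair :: "hterm \<Rightarrow> hterm \<Rightarrow> hterm \<Rightarrow> hterm \<Rightarrow> hterm \<Rightarrow> hterm \<Rightarrow> hterm" where
  "fib_pair A B f b a p = pair A (\<lambda>a. idt B (f \<cdot> a) b) a p"

definition piU :: "(hterm \<Rightarrow> hterm) \<Rightarrow> hterm" where
  "piU B = pi univ B"

definition lamU :: "(hterm \<Rightarrow> hterm) \<Rightarrow> hterm" where
  "lamU b = lam univ b"

subsection \<open>Univalence and function extensionality\<close>

definition ua_ty :: "hterm" where
  "ua_ty = piU (\<lambda>A. piU (\<lambda>B. eqv A B \<rightarrow> idt univ A B))"

text \<open>The centre of the fiber of \<open>id_to_eqv A B\<close> over \<open>w\<close>: a path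
  and an identification of its image with \<open>w\<close>.\<close>

definition ua_fib :: "hterm \<Rightarrow> hterm \<Rightarrow> hterm \<Rightarrow> hterm" where
  "ua_fib A B w = proj1 (fibre (idt univ A B) (eqv A B) (id_to_eqv A B) w)
     (univalence \<cdot> A \<cdot> B \<cdot> w)"

definition ua_pf :: "hterm" where
  "ua_pf = lamU (\<lambda>A. lamU (\<lambda>B. lam (eqv A B) (\<lambda>w. proj1 (idt univ A B) (ua_fib A B w))))"

lemma ua: "provable ua_ty"
  by (rule provableI[where t = ua_pf]) code_simp

definition eqv_ind_ty :: "hterm" where
  "eqv_ind_ty = piU (\<lambda>A. pi (piU (\<lambda>B. eqv A B \<rightarrow> univ)) (\<lambda>H.
     H \<cdot> A \<cdot> id_eqv A \<rightarrow> piU (\<lambda>B. pi (eqv A B) (\<lambda>w. H \<cdot> B \<cdot> w))))"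

definition eqv_ind_pf :: "hterm" where
  "eqv_ind_pf = lamU (\<lambda>A. lam (piU (\<lambda>B. eqv A B \<rightarrow> univ)) (\<lambda>H.
     lam (H \<cdot> A \<cdot> id_eqv A) (\<lambda>h. lamU (\<lambda>B. lam (eqv A B) (\<lambda>w.
       sig_ind (\<lambda>_. H \<cdot> B \<cdot> w)
         (\<lambda>p q. path_ind (\<lambda>v _. H \<cdot> B \<cdot> v) (path_ind (\<lambda>C r. H \<cdot> C \<cdot> (id_to_eqv A C \<cdot> r)) h p) q)
         (ua_fib A B w))))))"

text \<open>By univalence \<open>w\<close> is the image of a path; path induction makes that path
  \<open>rfl\<close>, whose image computes to \<open>id_eqv A\<close>.\<close>

lemma eqv_ind: "provable eqv_ind_ty"
  by (rule provableI[where t = eqv_ind_pf]) code_simp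

definition singl_prop_ty :: "hterm" where
  "singl_prop_ty = piU (\<lambda>A. pi A (\<lambda>a. is_prop (singl A a)))"

definition singl_prop_pf :: "hterm" where
  "singl_prop_pf = lamU (\<lambda>A. lam A (\<lambda>a. lam (singl A a) (\<lambda>u. lam (singl A a) (\<lambda>v.
     sig_ind (\<lambda>u. idt (singl A a) u v)
       (\<lambda>x p. sig_ind (\<lambda>v. idt (singl A a) (singl_pair A a x p) v)
         (\<lambda>y q. path_ind (\<lambda>x p. idt (singl A a) (singl_pair A a x p) (singl_pair A a y q))
           (path_ind (\<lambda>y q. idt (singl A a) (singl_pair A a a (rfl A a)) (singl_pair A a y q))
             (rfl (singl A a) (singl_pair A a a (rfl A a))) q) p) v) u))))"

lemma singl_prop: "provable singl_prop_ty"
  by (rule provableI[where t = singl_prop_pf]) code_simp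

text \<open>The identity stands on the left so that, for \<open>f\<close> the identity, this is the
  based path space \<open>singl (A \<rightarrow> A) (idfun A)\<close>.\<close>

definition right_inverses :: "hterm \<Rightarrow> hterm \<Rightarrow> hterm \<Rightarrow> hterm" where
  "right_inverses A B f = sig (B \<rightarrow> A) (\<lambda>g. idt (B \<rightarrow> B) (idfun B) (compose B f g))"

text \<open>
  By equivalence induction the equivalence may be taken to be the identity; then, up to the eta
  rule, the type of right inverses is a singleton.
\<close>

definition right_inverses_prop_ty :: "hterm" where
  "right_inverses_prop_ty = piU (\<lambda>A. piU (\<lambda>B. pi (eqv A B)
     (\<lambda>w. is_prop (right_inverses A B (proj1 (A \<rightarrow> B) w)))))"

definition right_inverses_prop_pf :: "hterm" where
  "right_inverses_prop_pf = lam eqv_ind_ty (\<lambda>eqv_ind. lam singl_prop_ty (\<lambda>singl_prop.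
     lamU (\<lambda>A. eqv_ind \<cdot> A \<cdot> (lamU (\<lambda>B. lam (eqv A B) (\<lambda>w. is_prop
        (right_inverses A B (proj1 (A \<rightarrow> B) w)))))
       \<cdot> (singl_prop \<cdot> (A \<rightarrow> A) \<cdot> idfun A))))"

lemma right_inverses_prop: "provable right_inverses_prop_ty"
proof -
  have "provable (eqv_ind_ty \<rightarrow> singl_prop_ty \<rightarrow> right_inverses_prop_ty)"
    by (rule provableI[where t = right_inverses_prop_pf]) code_simp
  then show ?thesis using eqv_ind singl_prop by (blast intro: provable_mp)
qed

definition total_space :: "hterm \<Rightarrow> hterm \<Rightarrow> hterm" where
  "total_space X A = sig X (\<lambda>x. A \<cdot> x)"

definition sections :: "hterm \<Rightarrow> hterm \<Rightarrow> hterm" where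
  "sections X A = pi X (\<lambda>x. A \<cdot> x)"

definition fstmap :: "hterm \<Rightarrow> hterm \<Rightarrow> hterm" where
  "fstmap X A = lam (total_space X A) (\<lambda>z. proj1 X z)"

definition fst_equiv_ty :: "hterm" where
  "fst_equiv_ty = piU (\<lambda>X. pi (X \<rightarrow> univ) (\<lambda>A. sections X A \<rightarrow> pi X (\<lambda>x. is_prop (A \<cdot> x)) \<rightarrow>
     is_eqv (total_space X A) X (fstmap X A)))"

definition contr_pair :: "hterm \<Rightarrow> hterm \<Rightarrow> hterm \<Rightarrow> hterm" where
  "contr_pair F c h = pair F (\<lambda>c. pi F (\<lambda>w. idt F c w)) c h"

definition fst_fib :: "hterm \<Rightarrow> hterm \<Rightarrow> hterm \<Rightarrow> hterm" where
  "fst_fib X A x = fibre (total_space X A) X (fstmap X A) x"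

definition fst_fib_pair :: "hterm \<Rightarrow> hterm \<Rightarrow> hterm \<Rightarrow> hterm \<Rightarrow> hterm \<Rightarrow> hterm" where
  "fst_fib_pair X A x z q = fib_pair (total_space X A) X (fstmap X A) x z q"

definition fst_centre :: "hterm \<Rightarrow> hterm \<Rightarrow> hterm \<Rightarrow> hterm \<Rightarrow> hterm" where
  "fst_centre X A f x = fst_fib_pair X A x (pair X (\<lambda>x. A \<cdot> x) x (f \<cdot> x)) (rfl X x)"

definition fst_equiv_pf :: "hterm" where
  "fst_equiv_pf = lamU (\<lambda>X. lam (X \<rightarrow> univ) (\<lambda>A. lam (sections X A)
     (\<lambda>f. lam (pi X (\<lambda>x. is_prop (A \<cdot> x))) (\<lambda>i.
     lam X (\<lambda>x. contr_pair (fst_fib X A x) (fst_centre X A f x) (lam (fst_fib X A x) (\<lambda>w.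
       sig_ind (\<lambda>w. idt (fst_fib X A x) (fst_centre X A f x) w)
         (\<lambda>z q. path_ind (\<lambda>x q. idt (fst_fib X A x) (fst_centre X A f x) (fst_fib_pair X A x z q))
           (sig_ind (\<lambda>z. idt (fst_fib X A (proj1 X z)) (fst_centre X A f (proj1 X z))
                          (fst_fib_pair X A (proj1 X z) z (rfl X (proj1 X z))))
             (\<lambda>x a. path_ind (\<lambda>b _. idt (fst_fib X A x) (fst_centre X A f x)
                               (fst_fib_pair X A x (pair X (\<lambda>x. A \<cdot> x) x b) (rfl X x)))
               (rfl (fst_fib X A x) (fst_centre X A f x)) (i \<cdot> x \<cdot> (f \<cdot> x) \<cdot> a)) z) q) w)))))))"

text \<open>Path induction on \<open>q\<close> turns \<open>x\<close> into the first component of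
  \<open>z\<close>; once \<open>z\<close> is split, only \<open>f x = a\<close> in the proposition
  \<open>A x\<close> remains.\<close>

lemma fst_equiv: "provable fst_equiv_ty"
  by (rule provableI[where t = fst_equiv_pf]) code_simp

text \<open>
  If all \<open>A x\<close> are propositions and \<open>A\<close> has a section, then the first projection is an equivalence,
  and the sections of \<open>A\<close> are a definitional retract of its right inverses.
\<close>

definition weak_funext_ty :: "hterm" where
  "weak_funext_ty = piU (\<lambda>X. pi (X \<rightarrow> univ) (\<lambda>A. pi X (\<lambda>x. is_prop (A \<cdot> x)) \<rightarrow> is_prop
     (sections X A)))"

definition section_to_right_inverse :: "hterm \<Rightarrow> hterm \<Rightarrow> hterm \<Rightarrow> hterm" where
  "section_to_right_inverse X A f = pair (X \<rightarrow> total_space X A)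
     (\<lambda>g. idt (X \<rightarrow> X) (idfun X) (compose X (fstmap X A) g))
     (lam X (\<lambda>x. pair X (\<lambda>x. A \<cdot> x) x (f \<cdot> x))) (rfl (X \<rightarrow> X) (idfun X))"

text \<open>Transports the second component of \<open>g x\<close> along \<open>p\<close>. On
  \<open>section_to_right_inverse X A f\<close> the path is \<open>rfl\<close>, and the result
  reduces to \<open>f\<close> by eta.\<close>

definition right_inverse_to_section :: "hterm \<Rightarrow> hterm \<Rightarrow> hterm \<Rightarrow> hterm" where
  "right_inverse_to_section X A s = sig_ind (\<lambda>_. sections X A)
     (\<lambda>g p. lam X (\<lambda>x. path_ind (\<lambda>h _. A \<cdot> (h \<cdot> x) \<rightarrow> A \<cdot> x) (idfun (A \<cdot> x)) p
        \<cdot> (proj2 X (\<lambda>x. A \<cdot> x) (g \<cdot> x)))) s"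

definition weak_funext_pf :: "hterm" where
  "weak_funext_pf = lam right_inverses_prop_ty (\<lambda>right_inverses_prop. lam fst_equiv_ty
     (\<lambda>fst_equiv.
     lamU (\<lambda>X. lam (X \<rightarrow> univ) (\<lambda>A. lam (pi X (\<lambda>x. is_prop (A \<cdot> x))) (\<lambda>i.
       lam (sections X A) (\<lambda>f. lam (sections X A) (\<lambda>g.
         path_ind (\<lambda>s _. idt (sections X A) f (right_inverse_to_section X A s))
            (rfl (sections X A) f)
           (right_inverses_prop \<cdot> total_space X A \<cdot> X
             \<cdot> pair (total_space X A \<rightarrow> X) (\<lambda>f. is_eqv (total_space X A) X f) (fstmap X A)
                (fst_equiv \<cdot> X \<cdot> A \<cdot> f \<cdot> i)
             \<cdot> section_to_right_inverse X A f \<cdot> section_to_right_inverse X A g))))))))"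

lemma weak_funext: "provable weak_funext_ty"
proof -
  have "provable (right_inverses_prop_ty \<rightarrow> fst_equiv_ty \<rightarrow> weak_funext_ty)"
    by (rule provableI[where t = weak_funext_pf]) code_simp
  then show ?thesis using right_inverses_prop fst_equiv by (blast intro: provable_mp)
qed

definition funext_ty :: "hterm" where
  "funext_ty = piU (\<lambda>X. pi (X \<rightarrow> univ) (\<lambda>A. pi (sections X A) (\<lambda>f. pi (sections X A) (\<lambda>g.
     pi X (\<lambda>x. idt (A \<cdot> x) (f \<cdot> x) (g \<cdot> x)) \<rightarrow> idt (sections X A) f g))))"

definition funext_pf :: "hterm" where
  "funext_pf = lam weak_funext_ty (\<lambda>weak_funext. lam singl_prop_ty (\<lambda>singl_prop.
     lamU (\<lambda>X. lam (X \<rightarrow> univ) (\<lambda>A. lam (sections X A) (\<lambda>f. lam (sections X A) (\<lambda>g.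
       lam (pi X (\<lambda>x. idt (A \<cdot> x) (f \<cdot> x) (g \<cdot> x))) (\<lambda>h.
         path_ind (\<lambda>s _. idt (sections X A) f (lam X (\<lambda>x. proj1 (A \<cdot> x) (s \<cdot> x))))
            (rfl (sections X A) f)
           (weak_funext \<cdot> X \<cdot> lam X (\<lambda>x. singl (A \<cdot> x) (f \<cdot> x))
             \<cdot> lam X (\<lambda>x. singl_prop \<cdot> (A \<cdot> x) \<cdot> (f \<cdot> x))
             \<cdot> lam X (\<lambda>x. singl_pair (A \<cdot> x) (f \<cdot> x) (f \<cdot> x) (rfl (A \<cdot> x) (f \<cdot> x)))
             \<cdot> lam X (\<lambda>x. singl_pair (A \<cdot> x) (f \<cdot> x) (g \<cdot> x) (h \<cdot> x))))))))))"

text \<open>Weak extensionality for the singletons at \<open>f x\<close> identifies the sections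
  \<open>(f x, rfl)\<close> and \<open>(g x, h x)\<close>; first components give
  \<open>f = g\<close>.\<close>

lemma funext: "provable funext_ty"
proof -
  have "provable (weak_funext_ty \<rightarrow> singl_prop_ty \<rightarrow> funext_ty)"
    by (rule provableI[where t = funext_pf]) code_simp
  then show ?thesis using weak_funext singl_prop by (blast intro: provable_mp)
qed

subsection \<open>Propositions\<close>

text \<open>The path \<open>r\<inverse> \<bullet> s\<close> from \<open>a\<close> to \<open>b\<close>, for \<open>r : x = a\<close> and \<open>s : x = b\<close>.\<close>

definition joinp :: "hterm \<Rightarrow> hterm \<Rightarrow> hterm \<Rightarrow> hterm \<Rightarrow> hterm" where
  "joinp X b r s = path_ind (\<lambda>y _. idt X y b) s r"

definition joinp_self_ty :: "hterm" where
  "joinp_self_ty = piU (\<lambda>X. pi X (\<lambda>x. pi X (\<lambda>y. pi (idt X x y) (\<lambda>r.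
     idt (idt X y y) (rfl X y) (joinp X y r r)))))"

definition joinp_self_pf :: "hterm" where
  "joinp_self_pf = lamU (\<lambda>X. lam X (\<lambda>x. lam X (\<lambda>y. lam (idt X x y) (\<lambda>r.
     path_ind (\<lambda>y r. idt (idt X y y) (rfl X y) (joinp X y r r)) (rfl (idt X x x) (rfl X x)) r))))"

lemma joinp_self: "provable joinp_self_ty"
  by (rule provableI[where t = joinp_self_pf]) code_simp

definition prop_set_ty :: "hterm" where
  "prop_set_ty = piU (\<lambda>X. is_prop X \<rightarrow> pi X (\<lambda>x. pi X (\<lambda>y. is_prop (idt X x y))))"

text \<open>
  The path \<open>path_const X i x y\<close> does not depend on a given \<open>p : x = y\<close>, and path induction identifies it
  with \<open>p\<close>: this is Hedberg's argument.
\<close>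

definition path_const :: "hterm \<Rightarrow> hterm \<Rightarrow> hterm \<Rightarrow> hterm \<Rightarrow> hterm" where
  "path_const X i x y = joinp X y (i \<cdot> x \<cdot> x) (i \<cdot> x \<cdot> y)"

definition prop_set_pf :: "hterm" where
  "prop_set_pf = lam joinp_self_ty (\<lambda>joinp_self. lamU (\<lambda>X. lam (is_prop X) (\<lambda>i. lam X (\<lambda>x.
     (lam (pi X (\<lambda>y. pi (idt X x y) (\<lambda>p. idt (idt X x y) p (path_const X i x y)))) (\<lambda>e.
       lam X (\<lambda>y. lam (idt X x y) (\<lambda>p. lam (idt X x y) (\<lambda>q.
         path_ind (\<lambda>s _. idt (idt X x y) p s \<rightarrow> idt (idt X x y) p q)
             (idfun (idt (idt X x y) p q)) (e \<cdot> y \<cdot> q)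
           \<cdot> (e \<cdot> y \<cdot> p))))))
     \<cdot> lam X (\<lambda>y. lam (idt X x y) (\<lambda>p.
         path_ind (\<lambda>y p. idt (idt X x y) p (path_const X i x y))
            (joinp_self \<cdot> X \<cdot> x \<cdot> x \<cdot> (i \<cdot> x \<cdot> x)) p))))))"

lemma prop_set: "provable prop_set_ty"
proof -
  have "provable (joinp_self_ty \<rightarrow> prop_set_ty)"
    by (rule provableI[where t = prop_set_pf]) code_simp
  then show ?thesis using joinp_self by (blast intro: provable_mp)
qed

definition isprop_prop_ty :: "hterm" where
  "isprop_prop_ty = piU (\<lambda>X. is_prop (is_prop X))"

definition isprop_prop_pf :: "hterm" where
  "isprop_prop_pf = lam weak_funext_ty (\<lambda>weak_funext. lam prop_set_ty (\<lambda>prop_set.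
     lamU (\<lambda>X. lam (is_prop X) (\<lambda>i. lam (is_prop X) (\<lambda>j.
       weak_funext \<cdot> X \<cdot> lam X (\<lambda>x. pi X (\<lambda>y. idt X x y))
         \<cdot> lam X (\<lambda>x. weak_funext \<cdot> X \<cdot> lam X (\<lambda>y. idt X x y) \<cdot> (prop_set \<cdot> X \<cdot> i \<cdot> x))
         \<cdot> i \<cdot> j)))))"

text \<open>Given \<open>i\<close>, the identity types of \<open>X\<close> are propositions by
  \<open>prop_set\<close>; two uses of weak extensionality lift this to the double product.\<close>

lemma isprop_prop: "provable isprop_prop_ty"
proof -
  have "provable (weak_funext_ty \<rightarrow> prop_set_ty \<rightarrow> isprop_prop_ty)"
    by (rule provableI[where t = isprop_prop_pf]) code_simp
  then show ?thesis using weak_funext prop_set by (blast intro: provable_mp)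
qed

section \<open>Inhabited propositions equal the true proposition\<close>

definition unit_prop :: "hterm" where
  "unit_prop = lam unit_ty (\<lambda>x. lam unit_ty (\<lambda>y.
     unit_ind (\<lambda>x. idt unit_ty x y) (unit_ind (\<lambda>y. idt unit_ty star y) (rfl unit_ty star) y) x))"

definition omega_of :: "hterm \<Rightarrow> hterm \<Rightarrow> hterm" where
  "omega_of P i = pair univ is_prop P i"

definition truth :: "hterm" where
  "truth = omega_of unit_ty unit_prop"

definition constmap :: "hterm \<Rightarrow> hterm" where
  "constmap a = lam unit_ty (\<lambda>_. a)"

definition const_equiv_ty :: "hterm" where
  "const_equiv_ty = piU (\<lambda>P. is_prop P \<rightarrow> pi P (\<lambda>a. is_eqv unit_ty P (constmap a)))"

definition const_fib :: "hterm \<Rightarrow> hterm \<Rightarrow> hterm \<Rightarrow> hterm" where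
  "const_fib P a y = fibre unit_ty P (constmap a) y"

definition const_fib_pair :: "hterm \<Rightarrow> hterm \<Rightarrow> hterm \<Rightarrow> hterm \<Rightarrow> hterm \<Rightarrow> hterm" where
  "const_fib_pair P a y x q = fib_pair unit_ty P (constmap a) y x q"

definition const_equiv_pf :: "hterm" where
  "const_equiv_pf = lam prop_set_ty (\<lambda>prop_set. lamU (\<lambda>P. lam (is_prop P)
     (\<lambda>i. lam P (\<lambda>a. lam P (\<lambda>y.
     contr_pair (const_fib P a y) (const_fib_pair P a y star (i \<cdot> a \<cdot> y))
        (lam (const_fib P a y) (\<lambda>w.
       sig_ind (\<lambda>w. idt (const_fib P a y) (const_fib_pair P a y star (i \<cdot> a \<cdot> y)) w)
         (\<lambda>x q. unit_ind
            (\<lambda>x. pi (idt P (constmap a \<cdot> x) y) (\<lambda>q.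
               idt (const_fib P a y) (const_fib_pair P a y star (i \<cdot> a \<cdot> y))
                  (const_fib_pair P a y x q)))
            (lam (idt P a y) (\<lambda>q.
               path_ind (\<lambda>q _. idt (const_fib P a y) (const_fib_pair P a y star (i \<cdot> a \<cdot> y))
                  (const_fib_pair P a y star q))
                 (rfl (const_fib P a y) (const_fib_pair P a y star (i \<cdot> a \<cdot> y)))
                 (prop_set \<cdot> P \<cdot> i \<cdot> a \<cdot> y \<cdot> (i \<cdot> a \<cdot> y) \<cdot> q)))
            x \<cdot> q) w)))))))"

text \<open>The fiber over \<open>y\<close> has centre \<open>(star, i a y)\<close>; its path
  component is unique because \<open>P\<close> is a set.\<close>

lemma const_equiv: "provable const_equiv_ty"
proof -
  have "provable (prop_set_ty \<rightarrow> const_equiv_ty)"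
    by (rule provableI[where t = const_equiv_pf]) code_simp
  then show ?thesis using prop_set by (blast intro: provable_mp)
qed

definition true_eq_ty :: "hterm" where
  "true_eq_ty = pi omega (\<lambda>\<omega>. proj1 univ \<omega> \<rightarrow> idt omega \<omega> truth)"

definition true_eq_pf :: "hterm" where
  "true_eq_pf = lam ua_ty (\<lambda>ua. lam const_equiv_ty (\<lambda>const_equiv. lam isprop_prop_ty
     (\<lambda>isprop_prop.
     lam omega (\<lambda>\<omega>. sig_ind (\<lambda>\<omega>. proj1 univ \<omega> \<rightarrow> idt omega \<omega> truth)
       (\<lambda>P i. lam P (\<lambda>a.
          path_ind (\<lambda>P _. pi (is_prop P) (\<lambda>i. idt omega (omega_of P i) truth))
            (lam (is_prop unit_ty) (\<lambda>i. path_ind (\<lambda>j _. idt omega (omega_of unit_ty i)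
               (omega_of unit_ty j))
               (rfl omega (omega_of unit_ty i)) (isprop_prop \<cdot> unit_ty \<cdot> i \<cdot> unit_prop)))
            (ua \<cdot> unit_ty \<cdot> P \<cdot> pair (unit_ty \<rightarrow> P) (\<lambda>f. is_eqv unit_ty P f) (constmap a)
               (const_equiv \<cdot> P \<cdot> i \<cdot> a))
          \<cdot> i)) \<omega>))))"

text \<open>Univalence turns \<open>const_equiv\<close> into a path from \<open>unit_ty\<close> to
  \<open>P\<close>. After path induction only two proofs that \<open>unit_ty\<close> is a
  proposition are compared.\<close>

lemma true_eq: "provable true_eq_ty"
proof -
  have "provable (ua_ty \<rightarrow> const_equiv_ty \<rightarrow> isprop_prop_ty \<rightarrow> true_eq_ty)"
    by (rule provableI[where t = true_eq_pf]) code_simp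
  then show ?thesis using ua const_equiv isprop_prop by (blast intro: provable_mp)
qed

subsection \<open>The partial map classifier\<close>

text \<open>
  The partial map classifier of \<open>D\<close>, where \<open>El : Q \<rightarrow> univ\<close> decodes the elements of the small
  copy \<open>Q\<close> of the type of propositions and \<open>t : Q\<close> is the code of a true proposition.
\<close>

definition plift :: "hterm \<Rightarrow> hterm \<Rightarrow> hterm \<Rightarrow> hterm" where
  "plift Q El D = sig Q (\<lambda>p. El \<cdot> p \<rightarrow> D)"

definition plift_pair :: "hterm \<Rightarrow> hterm \<Rightarrow> hterm \<Rightarrow> hterm \<Rightarrow> hterm \<Rightarrow> hterm" where
  "plift_pair Q El D p \<phi> = pair Q (\<lambda>p. El \<cdot> p \<rightarrow> D) p \<phi>"

definition plift_in :: "hterm \<Rightarrow> hterm \<Rightarrow> hterm \<Rightarrow> hterm \<Rightarrow> hterm" where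
  "plift_in Q El t D = lam D (\<lambda>x. plift_pair Q El D t (lam (El \<cdot> t) (\<lambda>_. x)))"

definition total_eq :: "hterm \<Rightarrow> hterm \<Rightarrow> hterm \<Rightarrow> hterm \<Rightarrow> hterm" where
  "total_eq Q El t D = pi Q (\<lambda>p. pi (El \<cdot> p \<rightarrow> D) (\<lambda>\<phi>. pi (El \<cdot> p) (\<lambda>u.
     idt (plift Q El D) (plift_in Q El t D \<cdot> (\<phi> \<cdot> u)) (plift_pair Q El D p \<phi>))))"

definition total_eq_ty :: "hterm" where
  "total_eq_ty = piU (\<lambda>Q. pi (Q \<rightarrow> univ) (\<lambda>El. pi Q (\<lambda>p. is_prop (El \<cdot> p)) \<rightarrow> pi Q (\<lambda>t.
     pi Q (\<lambda>p. El \<cdot> p \<rightarrow> idt Q t p) \<rightarrow> piU (\<lambda>D. total_eq Q El t D))))"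

definition total_eq_pf :: "hterm" where
  "total_eq_pf = lam funext_ty (\<lambda>funext. lamU (\<lambda>Q. lam (Q \<rightarrow> univ) (\<lambda>El.
     lam (pi Q (\<lambda>p. is_prop (El \<cdot> p))) (\<lambda>i. lam Q (\<lambda>t. lam (pi Q (\<lambda>p. El \<cdot> p \<rightarrow> idt Q t p)) (\<lambda>tt.
       lamU (\<lambda>D. lam Q (\<lambda>p. lam (El \<cdot> p \<rightarrow> D) (\<lambda>\<phi>. lam (El \<cdot> p) (\<lambda>u.
         path_ind (\<lambda>p _. pi (El \<cdot> p \<rightarrow> D) (\<lambda>\<phi>. pi (El \<cdot> p) (\<lambda>u.
               idt (plift Q El D) (plift_in Q El t D \<cdot> (\<phi> \<cdot> u)) (plift_pair Q El D p \<phi>))))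
           (lam (El \<cdot> t \<rightarrow> D) (\<lambda>\<phi>. lam (El \<cdot> t) (\<lambda>u.
              path_ind (\<lambda>\<psi> _. idt (plift Q El D) (plift_in Q El t D \<cdot> (\<phi> \<cdot> u))
                 (plift_pair Q El D t \<psi>))
                (rfl (plift Q El D) (plift_in Q El t D \<cdot> (\<phi> \<cdot> u)))
                (funext \<cdot> (El \<cdot> t) \<cdot> lam (El \<cdot> t) (\<lambda>_. D) \<cdot> lam (El \<cdot> t) (\<lambda>_. \<phi> \<cdot> u) \<cdot> \<phi>
                  \<cdot> lam (El \<cdot> t) (\<lambda>v. path_ind (\<lambda>v _. idt D (\<phi> \<cdot> u) (\<phi> \<cdot> v)) (rfl D (\<phi> \<cdot> u))
                     (i \<cdot> t \<cdot> u \<cdot> v))))))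
           (tt \<cdot> p \<cdot> u) \<cdot> \<phi> \<cdot> u))))))))))"

text \<open>The path \<open>tt p u\<close> reduces the claim to \<open>p = t\<close>. As
  \<open>El p\<close> is a proposition, \<open>\<phi>\<close> is pointwise constant, and function
  extensionality applies.\<close>

lemma total_eq: "provable total_eq_ty"
proof -
  have "provable (funext_ty \<rightarrow> total_eq_ty)"
    by (rule provableI[where t = total_eq_pf]) code_simp
  then show ?thesis using funext by (blast intro: provable_mp)
qed

definition plift_fib :: "hterm \<Rightarrow> hterm \<Rightarrow> hterm \<Rightarrow> hterm \<Rightarrow> hterm \<Rightarrow> hterm" where
  "plift_fib Q El t D m = fibre D (plift Q El D) (plift_in Q El t D) m"

definition plift_fib_pair :: "hterm \<Rightarrow> hterm \<Rightarrow> hterm \<Rightarrow> hterm \<Rightarrow> hterm \<Rightarrow> hterm \<Rightarrow> hterm \<Rightarrow> hterm" where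
  "plift_fib_pair Q El t D m x q = fib_pair D (plift Q El D) (plift_in Q El t D) m x q"

definition plift_emb_ty :: "hterm" where
  "plift_emb_ty = piU (\<lambda>Q. pi (Q \<rightarrow> univ) (\<lambda>El. pi Q (\<lambda>p. is_prop (El \<cdot> p)) \<rightarrow> pi Q (\<lambda>t.
     El \<cdot> t \<rightarrow> piU (\<lambda>D. total_eq Q El t D \<rightarrow> is_emb D (plift Q El D) (plift_in Q El t D)))))"

text \<open>
  The correction by \<open>K \<cdot> t\<close> makes \<open>fib_of\<close> send the element arising from \<open>(x, rfl)\<close> to
  \<open>(x, r\<inverse> \<bullet> r)\<close> for a path \<open>r\<close>, whatever \<open>K\<close> is. So no computation rule for function extensionality,
  which enters \<open>K\<close>, is needed.
\<close>

definition fib_of :: "hterm \<Rightarrow> hterm \<Rightarrow> hterm \<Rightarrow> hterm \<Rightarrow> hterm \<Rightarrow> hterm \<Rightarrow> hterm \<Rightarrow> hterm" where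
  "fib_of Q El t D K tru m = sig_ind (\<lambda>m. El \<cdot> proj1 Q m \<rightarrow> plift_fib Q El t D m)
     (\<lambda>p \<phi>. lam (El \<cdot> p) (\<lambda>u. plift_fib_pair Q El t D (plift_pair Q El D p \<phi>) (\<phi> \<cdot> u)
        (joinp (plift Q El D) (plift_pair Q El D p \<phi>)
          (K \<cdot> t \<cdot> lam (El \<cdot> t) (\<lambda>_. \<phi> \<cdot> u) \<cdot> tru) (K \<cdot> p \<cdot> \<phi> \<cdot> u)))) m"

text \<open>The domain of \<open>plift_in x\<close> is \<open>El t\<close>, so \<open>tru\<close>
  can be transported along \<open>q\<close> to the domain of \<open>m\<close>.\<close>

definition fib_dom :: "hterm \<Rightarrow> hterm \<Rightarrow> hterm \<Rightarrow> hterm \<Rightarrow> hterm \<Rightarrow> hterm \<Rightarrow> hterm \<Rightarrow> hterm" where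
  "fib_dom Q El t D tru m w = sig_ind (\<lambda>_. El \<cdot> proj1 Q m)
     (\<lambda>_ q. path_ind (\<lambda>m _. El \<cdot> proj1 Q m) tru q) w"

definition fib_retract_ty :: "hterm" where
  "fib_retract_ty = piU (\<lambda>Q. pi (Q \<rightarrow> univ) (\<lambda>El. pi Q (\<lambda>t. pi (El \<cdot> t) (\<lambda>tru. piU (\<lambda>D.
     pi (total_eq Q El t D) (\<lambda>K. pi (plift Q El D) (\<lambda>m. pi (plift_fib Q El t D m) (\<lambda>w.
       idt (plift_fib Q El t D m) w (fib_of Q El t D K tru m \<cdot> fib_dom Q El t D tru m w)))))))))"

definition fib_retract_pf :: "hterm" where
  "fib_retract_pf = lam joinp_self_ty (\<lambda>joinp_self. lamU (\<lambda>Q. lam (Q \<rightarrow> univ) (\<lambda>El. lam Q (\<lambda>t.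
     lam (El \<cdot> t) (\<lambda>tru. lamU (\<lambda>D. lam (total_eq Q El t D) (\<lambda>K. lam (plift Q El D) (\<lambda>m.
       lam (plift_fib Q El t D m) (\<lambda>w. sig_ind
         (\<lambda>w. idt (plift_fib Q El t D m) w (fib_of Q El t D K tru m \<cdot> fib_dom Q El t D tru m w))
         (\<lambda>x q. path_ind (\<lambda>m q. idt (plift_fib Q El t D m) (plift_fib_pair Q El t D m x q)
                (fib_of Q El t D K tru m \<cdot> fib_dom Q El t D tru m
                   (plift_fib_pair Q El t D m x q)))
           (path_ind (\<lambda>s _. idt (plift_fib Q El t D (plift_in Q El t D \<cdot> x))
                  (plift_fib_pair Q El t D (plift_in Q El t D \<cdot> x) x
                     (rfl (plift Q El D) (plift_in Q El t D \<cdot> x)))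
                  (plift_fib_pair Q El t D (plift_in Q El t D \<cdot> x) x s))
             (rfl (plift_fib Q El t D (plift_in Q El t D \<cdot> x))
               (plift_fib_pair Q El t D (plift_in Q El t D \<cdot> x) x
                 (rfl (plift Q El D) (plift_in Q El t D \<cdot> x))))
             (joinp_self \<cdot> plift Q El D \<cdot> (plift_in Q El t D \<cdot> x) \<cdot> (plift_in Q El t D \<cdot> x)
               \<cdot> (K \<cdot> t \<cdot> lam (El \<cdot> t) (\<lambda>_. x) \<cdot> tru))) q) w)))))))))"

text \<open>After path induction \<open>m\<close> is \<open>plift_in x\<close>,
  \<open>fib_dom\<close> computes to \<open>tru\<close>, and both paths inside \<open>joinp\<close>
  coincide.\<close>

lemma fib_retract: "provable fib_retract_ty"
proof -
  have "provable (joinp_self_ty \<rightarrow> fib_retract_ty)"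
    by (rule provableI[where t = fib_retract_pf]) code_simp
  then show ?thesis using joinp_self by (blast intro: provable_mp)
qed

definition plift_emb_pf :: "hterm" where
  "plift_emb_pf = lam fib_retract_ty (\<lambda>fib_retract. lamU (\<lambda>Q. lam (Q \<rightarrow> univ) (\<lambda>El.
     lam (pi Q (\<lambda>p. is_prop (El \<cdot> p))) (\<lambda>i. lam Q (\<lambda>t. lam (El \<cdot> t) (\<lambda>tru. lamU (\<lambda>D.
       lam (total_eq Q El t D) (\<lambda>K. lam (plift Q El D) (\<lambda>m.
         lam (plift_fib Q El t D m) (\<lambda>w. lam (plift_fib Q El t D m) (\<lambda>z.
           path_ind (\<lambda>s _. idt (plift_fib Q El t D m) w s \<rightarrow> idt (plift_fib Q El t D m) w z)
             (idfun (idt (plift_fib Q El t D m) w z))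
             (fib_retract \<cdot> Q \<cdot> El \<cdot> t \<cdot> tru \<cdot> D \<cdot> K \<cdot> m \<cdot> z)
           \<cdot> path_ind (\<lambda>v _. idt (plift_fib Q El t D m) w (fib_of Q El t D K tru m \<cdot> v))
               (fib_retract \<cdot> Q \<cdot> El \<cdot> t \<cdot> tru \<cdot> D \<cdot> K \<cdot> m \<cdot> w)
               (i \<cdot> proj1 Q m \<cdot> fib_dom Q El t D tru m w \<cdot> fib_dom Q El t D tru m z))))))))))))"

text \<open>By the retraction, \<open>w\<close> and \<open>z\<close> are the values of
  \<open>fib_of\<close> at two points of one proposition. The implication in the motive reverses the
  path for \<open>z\<close>.\<close>

lemma plift_emb: "provable plift_emb_ty"
proof -
  have "provable (fib_retract_ty \<rightarrow> plift_emb_ty)"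
    by (rule provableI[where t = plift_emb_pf]) code_simp
  then show ?thesis using fib_retract by (blast intro: provable_mp)
qed

text \<open>With \<open>code_into\<close> this asks only that \<open>P\<close> and its decoded code
  be logically equivalent.\<close>

definition code_out :: "hterm \<Rightarrow> hterm \<Rightarrow> hterm \<Rightarrow> hterm" where
  "code_out Q El c = piU (\<lambda>P. pi (is_prop P) (\<lambda>i. El \<cdot> (c \<cdot> P \<cdot> i) \<rightarrow> P))"

definition code_into :: "hterm \<Rightarrow> hterm \<Rightarrow> hterm \<Rightarrow> hterm" where
  "code_into Q El c = piU (\<lambda>P. pi (is_prop P) (\<lambda>i. P \<rightarrow> El \<cdot> (c \<cdot> P \<cdot> i)))"

subsection \<open>Injective types\<close>

text \<open>The operation of algebraic flabbiness; \<open>filler_law\<close> is its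
  equation.\<close>

definition filler :: "hterm \<Rightarrow> hterm" where
  "filler D = piU (\<lambda>P. is_prop P \<rightarrow> (P \<rightarrow> D) \<rightarrow> D)"

definition filler_law :: "hterm \<Rightarrow> hterm \<Rightarrow> hterm" where
  "filler_law D s = piU (\<lambda>P. pi (is_prop P) (\<lambda>i. pi (P \<rightarrow> D)
     (\<lambda>g. pi P (\<lambda>a. idt D (s \<cdot> P \<cdot> i \<cdot> g) (g \<cdot> a)))))"

text \<open>
  A map \<open>f\<close> is extended along an embedding \<open>j\<close> by filling, over each \<open>y\<close>, the partial element of \<open>D\<close>
  that \<open>f\<close> defines on the fiber of \<open>j\<close> over \<open>y\<close>.
\<close>

definition flabby_alg_ty :: "hterm" where
  "flabby_alg_ty = piU (\<lambda>D. pi (filler D) (\<lambda>s. filler_law D s \<rightarrow> alg_injective D))"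

definition emb_fib :: "hterm \<Rightarrow> hterm \<Rightarrow> hterm \<Rightarrow> hterm \<Rightarrow> hterm" where
  "emb_fib X Y j y = fibre X Y (proj1 (X \<rightarrow> Y) j) y"

definition emb_fib_prop :: "hterm \<Rightarrow> hterm \<Rightarrow> hterm \<Rightarrow> hterm \<Rightarrow> hterm" where
  "emb_fib_prop X Y j y = proj2 (X \<rightarrow> Y) (\<lambda>j. is_emb X Y j) j \<cdot> y"

definition fib_val :: "hterm \<Rightarrow> hterm \<Rightarrow> hterm \<Rightarrow> hterm \<Rightarrow> hterm \<Rightarrow> hterm" where
  "fib_val X Y j f y = lam (emb_fib X Y j y) (\<lambda>w. f \<cdot> proj1 X w)"

text \<open>The point at which \<open>filler_law\<close> is evaluated over \<open>j x\<close>;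
  \<open>fib_val\<close> computes to \<open>f x\<close> there.\<close>

definition self_fib :: "hterm \<Rightarrow> hterm \<Rightarrow> hterm \<Rightarrow> hterm \<Rightarrow> hterm" where
  "self_fib X Y j x = fib_pair X Y (proj1 (X \<rightarrow> Y) j) (proj1 (X \<rightarrow> Y) j \<cdot> x) x
     (rfl Y (proj1 (X \<rightarrow> Y) j \<cdot> x))"

definition flabby_alg_pf :: "hterm" where
  "flabby_alg_pf = lamU (\<lambda>D. lam (filler D) (\<lambda>s. lam (filler_law D s) (\<lambda>h.
     lamU (\<lambda>X. lamU (\<lambda>Y. lam (embedding X Y) (\<lambda>j. lam (X \<rightarrow> D) (\<lambda>f.
       pair (Y \<rightarrow> D) (\<lambda>g. homot X D (compose X g (proj1 (X \<rightarrow> Y) j)) f)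
         (lam Y (\<lambda>y. s \<cdot> emb_fib X Y j y \<cdot> emb_fib_prop X Y j y \<cdot> fib_val X Y j f y))
         (lam X (\<lambda>x. h \<cdot> emb_fib X Y j (proj1 (X \<rightarrow> Y) j \<cdot> x)
            \<cdot> emb_fib_prop X Y j (proj1 (X \<rightarrow> Y) j \<cdot> x)
            \<cdot> fib_val X Y j f (proj1 (X \<rightarrow> Y) j \<cdot> x)
            \<cdot> self_fib X Y j x)))))))))"

lemma flabby_alg: "provable flabby_alg_ty"
  by (rule provableI[where t = flabby_alg_pf]) code_simp

section \<open>From a mere retraction of the classifier to mere algebraic injectivity\<close>

definition retract_filler :: "hterm \<Rightarrow> hterm \<Rightarrow> hterm \<Rightarrow> hterm \<Rightarrow> hterm \<Rightarrow> hterm \<Rightarrow> hterm" where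
  "retract_filler Q El c out D r = lamU (\<lambda>P. lam (is_prop P) (\<lambda>i. lam (P \<rightarrow> D) (\<lambda>g.
     r \<cdot> plift_pair Q El D (c \<cdot> P \<cdot> i) (lam (El \<cdot> (c \<cdot> P \<cdot> i)) (\<lambda>b. g \<cdot> (out \<cdot> P \<cdot> i \<cdot> b))))))"

definition retract_law_ty :: "hterm" where
  "retract_law_ty = piU (\<lambda>Q. pi (Q \<rightarrow> univ) (\<lambda>El. pi Q (\<lambda>t.
     pi (piU (\<lambda>P. is_prop P \<rightarrow> Q)) (\<lambda>c. pi (code_out Q El c) (\<lambda>out. code_into Q El c \<rightarrow>
       piU (\<lambda>D. total_eq Q El t D \<rightarrow> pi (plift Q El D \<rightarrow> D) (\<lambda>r.
         pi D (\<lambda>x. idt D (r \<cdot> (plift_in Q El t D \<cdot> x)) x) \<rightarrow>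
           filler_law D (retract_filler Q El c out D r))))))))"

definition retract_law_pf :: "hterm" where
  "retract_law_pf = lamU (\<lambda>Q. lam (Q \<rightarrow> univ) (\<lambda>El. lam Q (\<lambda>t.
     lam (piU (\<lambda>P. is_prop P \<rightarrow> Q)) (\<lambda>c. lam (code_out Q El c)
        (\<lambda>out. lam (code_into Q El c) (\<lambda>into.
       lamU (\<lambda>D. lam (total_eq Q El t D) (\<lambda>K. lam (plift Q El D \<rightarrow> D) (\<lambda>r.
         lam (pi D (\<lambda>x. idt D (r \<cdot> (plift_in Q El t D \<cdot> x)) x)) (\<lambda>\<rho>.
           lamU (\<lambda>P. lam (is_prop P) (\<lambda>i. lam (P \<rightarrow> D) (\<lambda>g. lam P (\<lambda>a.
             path_ind (\<lambda>s _. idt D (r \<cdot> s) (g \<cdot> a))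
               (path_ind (\<lambda>z _. idt D (r \<cdot> (plift_in Q El t D
                  \<cdot> (g \<cdot> (out \<cdot> P \<cdot> i \<cdot> (into \<cdot> P \<cdot> i \<cdot> a))))) (g \<cdot> z))
                 (\<rho> \<cdot> (g \<cdot> (out \<cdot> P \<cdot> i \<cdot> (into \<cdot> P \<cdot> i \<cdot> a))))
                 (i \<cdot> (out \<cdot> P \<cdot> i \<cdot> (into \<cdot> P \<cdot> i \<cdot> a)) \<cdot> a))
               (K \<cdot> (c \<cdot> P \<cdot> i) \<cdot> lam (El \<cdot> (c \<cdot> P \<cdot> i)) (\<lambda>b. g \<cdot> (out \<cdot> P \<cdot> i \<cdot> b))
                  \<cdot> (into \<cdot> P \<cdot> i \<cdot> a))))))))))))))))"

text \<open>For \<open>a\<close> in \<open>P\<close> the lifted partial element is total by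
  \<open>K\<close>, so \<open>r\<close> yields \<open>g (out (into a))\<close>, which is
  \<open>g a\<close> because \<open>P\<close> is a proposition.\<close>

lemma retract_law: "provable retract_law_ty"
  by (rule provableI[where t = retract_law_pf]) code_simp

definition inj_alg_ty :: "hterm" where
  "inj_alg_ty = piU (\<lambda>Q. pi (Q \<rightarrow> univ) (\<lambda>El. pi Q (\<lambda>p. is_prop (El \<cdot> p)) \<rightarrow> pi Q (\<lambda>t.
     El \<cdot> t \<rightarrow> pi Q (\<lambda>p. El \<cdot> p \<rightarrow> idt Q t p) \<rightarrow>
     pi (piU (\<lambda>P. is_prop P \<rightarrow> Q)) (\<lambda>c. code_out Q El c \<rightarrow> code_into Q El c \<rightarrow>
       piU (\<lambda>D. injective D \<rightarrow> trunc (alg_injective D))))))"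

definition trmap :: "hterm \<Rightarrow> hterm \<Rightarrow> (hterm \<Rightarrow> hterm) \<Rightarrow> hterm \<Rightarrow> hterm" where
  "trmap A B f z = trrec A (trunc B) \<cdot> trprop B \<cdot> lam A (\<lambda>x. trin B (f x)) \<cdot> z"

definition retraction_ext :: "hterm \<Rightarrow> hterm \<Rightarrow> hterm \<Rightarrow> hterm \<Rightarrow> hterm \<Rightarrow> hterm" where
  "retraction_ext Q El t D e = extension D (plift Q El D) D
     (pair (D \<rightarrow> plift Q El D) (\<lambda>f. is_emb D (plift Q El D) f) (plift_in Q El t D) e) (idfun D)"

definition inj_alg_pf :: "hterm" where
  "inj_alg_pf = lam total_eq_ty (\<lambda>total_equal. lam plift_emb_ty
     (\<lambda>plift_emb. lam retract_law_ty (\<lambda>retract_law. lam flabby_alg_ty (\<lambda>flabby_alg.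
     lamU (\<lambda>Q. lam (Q \<rightarrow> univ) (\<lambda>El. lam (pi Q (\<lambda>p. is_prop (El \<cdot> p))) (\<lambda>i. lam Q (\<lambda>t.
       lam (El \<cdot> t) (\<lambda>tru. lam (pi Q (\<lambda>p. El \<cdot> p \<rightarrow> idt Q t p)) (\<lambda>tt.
       lam (piU (\<lambda>P. is_prop P \<rightarrow> Q)) (\<lambda>c. lam (code_out Q El c)
          (\<lambda>out. lam (code_into Q El c) (\<lambda>into.
       lamU (\<lambda>D. lam (injective D) (\<lambda>z.
         (lam (total_eq Q El t D) (\<lambda>K. lam (is_emb D (plift Q El D) (plift_in Q El t D)) (\<lambda>e.
           trmap (retraction_ext Q El t D e) (alg_injective D)
             (\<lambda>x. sig_ind (\<lambda>_. alg_injective D)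
                (\<lambda>r \<rho>. flabby_alg \<cdot> D \<cdot> retract_filler Q El c out D r
                  \<cdot> (retract_law \<cdot> Q \<cdot> El \<cdot> t \<cdot> c \<cdot> out \<cdot> into \<cdot> D \<cdot> K \<cdot> r \<cdot> \<rho>)) x)
             (z \<cdot> D \<cdot> plift Q El D
               \<cdot> pair (D \<rightarrow> plift Q El D) (\<lambda>f. is_emb D (plift Q El D) f) (plift_in Q El t D) e
               \<cdot> idfun D))))
         \<cdot> (total_equal \<cdot> Q \<cdot> El \<cdot> i \<cdot> t \<cdot> tt \<cdot> D)
         \<cdot> (plift_emb \<cdot> Q \<cdot> El \<cdot> i \<cdot> t \<cdot> tru \<cdot> D \<cdot> (total_equal \<cdot> Q \<cdot> El \<cdot> i \<cdot> t \<cdot> tt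
            \<cdot> D)))))))))))))))))"

text \<open>As \<open>Q\<close> is small, the classifier lies in \<open>univ\<close>, and
  injectivity applies to \<open>plift_in\<close>. The goal is truncated, so \<open>trmap\<close>
  gives access to the retraction.\<close>

lemma inj_alg: "provable inj_alg_ty"
proof -
  have "provable (total_eq_ty \<rightarrow> plift_emb_ty \<rightarrow> retract_law_ty \<rightarrow> flabby_alg_ty \<rightarrow> inj_alg_ty)"
    by (rule provableI[where t = inj_alg_pf]) code_simp
  then show ?thesis using total_eq plift_emb retract_law flabby_alg by (blast intro: provable_mp)
qed

subsection \<open>Resizing\<close>

text \<open>What an equivalence supplies: a section \<open>enc\<close> of \<open>dec\<close>, and
  uniqueness of preimages.\<close>

definition coded_ty :: "hterm" where
  "coded_ty = piU (\<lambda>Q. pi (Q \<rightarrow> omega) (\<lambda>dec. pi (omega \<rightarrow> Q) (\<lambda>enc.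
     pi omega (\<lambda>\<omega>. idt omega (dec \<cdot> (enc \<cdot> \<omega>)) \<omega>) \<rightarrow>
     pi Q (\<lambda>p. pi omega (\<lambda>\<omega>. idt omega (dec \<cdot> p) \<omega> \<rightarrow> idt Q (enc \<cdot> \<omega>) p)) \<rightarrow>
     piU (\<lambda>D. injective D \<rightarrow> trunc (alg_injective D)))))"

definition holds :: "hterm \<Rightarrow> hterm \<Rightarrow> hterm" where
  "holds dec p = proj1 univ (dec \<cdot> p)"

definition coded_pf :: "hterm" where
  "coded_pf = lam inj_alg_ty (\<lambda>inj_alg. lam true_eq_ty (\<lambda>true_eq. lamU (\<lambda>Q.
     lam (Q \<rightarrow> omega) (\<lambda>dec. lam (omega \<rightarrow> Q) (\<lambda>enc.
     lam (pi omega (\<lambda>\<omega>. idt omega (dec \<cdot> (enc \<cdot> \<omega>)) \<omega>)) (\<lambda>s.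
     lam (pi Q (\<lambda>p. pi omega (\<lambda>\<omega>. idt omega (dec \<cdot> p) \<omega> \<rightarrow> idt Q (enc \<cdot> \<omega>) p))) (\<lambda>h.
     inj_alg \<cdot> Q \<cdot> lam Q (\<lambda>p. holds dec p)
       \<cdot> lam Q (\<lambda>p. proj2 univ is_prop (dec \<cdot> p))
       \<cdot> (enc \<cdot> truth)
       \<cdot> (path_ind (\<lambda>\<omega> _. proj1 univ \<omega> \<rightarrow> holds dec (enc \<cdot> truth))
            (idfun (holds dec (enc \<cdot> truth))) (s \<cdot> truth) \<cdot> star)
       \<cdot> lam Q (\<lambda>p. lam (holds dec p) (\<lambda>u. h \<cdot> p \<cdot> truth \<cdot> (true_eq \<cdot> (dec \<cdot> p) \<cdot> u)))
       \<cdot> lamU (\<lambda>P. lam (is_prop P) (\<lambda>i. enc \<cdot> omega_of P i))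
       \<cdot> lamU (\<lambda>P. lam (is_prop P) (\<lambda>i.
            path_ind (\<lambda>\<omega> _. holds dec (enc \<cdot> omega_of P i) \<rightarrow> proj1 univ \<omega>)
              (idfun (holds dec (enc \<cdot> omega_of P i))) (s \<cdot> omega_of P i)))
       \<cdot> lamU (\<lambda>P. lam (is_prop P) (\<lambda>i.
            path_ind (\<lambda>\<omega> _. proj1 univ \<omega> \<rightarrow> holds dec (enc \<cdot> omega_of P i))
              (idfun (holds dec (enc \<cdot> omega_of P i))) (s \<cdot> omega_of P i))))))))))"

text \<open>The true code is \<open>enc truth\<close>: if \<open>p\<close> holds,
  \<open>true_eq\<close> gives \<open>dec p = truth\<close>, whence \<open>enc truth = p\<close>.
  Transport along \<open>s\<close> relates \<open>P\<close> to its code.\<close>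

lemma coded: "provable coded_ty"
proof -
  have "provable (inj_alg_ty \<rightarrow> true_eq_ty \<rightarrow> coded_ty)"
    by (rule provableI[where t = coded_pf]) code_simp
  then show ?thesis using inj_alg true_eq by (blast intro: provable_mp)
qed

definition resized_ty :: "hterm" where
  "resized_ty = piU (\<lambda>Q. eqv Q omega \<rightarrow> piU (\<lambda>D. injective D \<rightarrow> trunc (alg_injective D)))"

definition eqv_centre :: "hterm \<Rightarrow> hterm \<Rightarrow> hterm \<Rightarrow> hterm \<Rightarrow> hterm \<Rightarrow> hterm" where
  "eqv_centre A B f e b = proj1 (fibre A B f b) (e \<cdot> b)"

definition resized_pf :: "hterm" where
  "resized_pf = lam coded_ty (\<lambda>coded. lamU (\<lambda>Q. lam (eqv Q omega) (\<lambda>E.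
     sig_ind (\<lambda>_. piU (\<lambda>D. injective D \<rightarrow> trunc (alg_injective D)))
       (\<lambda>dec e. coded \<cdot> Q \<cdot> dec \<cdot> lam omega (\<lambda>\<omega>. proj1 Q (eqv_centre Q omega dec e \<omega>))
          \<cdot> lam omega (\<lambda>\<omega>. proj2 Q (\<lambda>p. idt omega (dec \<cdot> p) \<omega>) (eqv_centre Q omega dec e \<omega>))
          \<cdot> lam Q (\<lambda>p. lam omega (\<lambda>\<omega>. lam (idt omega (dec \<cdot> p) \<omega>) (\<lambda>q.
               path_ind (\<lambda>s _. idt Q (proj1 Q (eqv_centre Q omega dec e \<omega>)) (proj1 Q s))
                 (rfl Q (proj1 Q (eqv_centre Q omega dec e \<omega>)))
                 (proj2 (fibre Q omega dec \<omega>) (\<lambda>c. pi (fibre Q omega dec \<omega>)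
                    (\<lambda>w. idt (fibre Q omega dec \<omega>) c w)) (e \<cdot> \<omega>)
                   \<cdot> fib_pair Q omega dec \<omega> p q))))) E)))"

text \<open>Centres of the fibers give \<open>enc\<close> and its section law; their contractions
  give uniqueness of preimages.\<close>

lemma resized: "provable resized_ty"
proof -
  have "provable (coded_ty \<rightarrow> resized_ty)"
    by (rule provableI[where t = resized_pf]) code_simp
  then show ?thesis using coded by (blast intro: provable_mp)
qed

section \<open>The converse direction and the equivalence\<close>

definition alg_inj_ty :: "hterm" where
  "alg_inj_ty = piU (\<lambda>D. trunc (alg_injective D) \<rightarrow> injective D)"

definition alg_inj_pf :: "hterm" where
  "alg_inj_pf = lamU (\<lambda>D. lam (trunc (alg_injective D)) (\<lambda>z.
     lamU (\<lambda>X. lamU (\<lambda>Y. lam (embedding X Y) (\<lambda>j. lam (X \<rightarrow> D) (\<lambda>f.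
       trmap (alg_injective D) (extension X Y D j f) (\<lambda>a. a \<cdot> X \<cdot> Y \<cdot> j \<cdot> f) z))))))"

text \<open>Each value of an injectivity proof is a truncation, so the structure can be evaluated
  under \<open>trmap\<close>.\<close>

lemma alg_inj: "provable alg_inj_ty"
  by (rule provableI[where t = alg_inj_pf]) code_simp

definition main_ty :: "hterm" where
  "main_ty = resizing \<rightarrow> piU (\<lambda>D. iff (injective D) (trunc (alg_injective D)))"

definition main_pf :: "hterm" where
  "main_pf = lam resized_ty (\<lambda>resized. lam alg_inj_ty (\<lambda>alg_inj.
     lam resizing (\<lambda>R. lamU (\<lambda>D.
       pair (injective D \<rightarrow> trunc (alg_injective D)) (\<lambda>_. trunc (alg_injective D) \<rightarrow> injective D)
         (sig_ind (\<lambda>_. injective D \<rightarrow> trunc (alg_injective D)) (\<lambda>Q E. resized \<cdot> Q \<cdot> E \<cdot> D) R)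
         (alg_inj \<cdot> D)))))"

lemma main: "provable main_ty"
proof -
  have "provable (resized_ty \<rightarrow> alg_inj_ty \<rightarrow> main_ty)"
    by (rule provableI[where t = main_pf]) code_simp
  then show ?thesis using resized alg_inj by (blast intro: provable_mp)
qed

theorem theorem54:
  fixes T :: "'l::universe_level"
  shows "\<exists>t. [] \<turnstile> t \<^bold>:
    arr (Omega_resizing T)
      (TPi (TUniv T)
        (iff_ty (injective_ty T T (Var 0)) (TTrunc (alg_injective_ty T T (Var 0)))))"
proof -
  obtain t where "[] \<turnstile> t \<^bold>: main_ty 0" using main by (auto simp: provable_def)
  \<comment> \<open>Relabelling sends level 0 to \<open>T\<close> and successors to
    successors.\<close>
  then have "map (map_tm (level_from T)) [] \<turnstile> map_tm (level_from T) t
      \<^bold>: map_tm (level_from T) (main_ty 0)"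
    by (rule has_type_map_tm(2)[rotated 2]) (simp_all add: level_from_sup)
  moreover have "map_tm (level_from T) (main_ty 0) = arr (Omega_resizing T)
      (TPi (TUniv T)
        (iff_ty (injective_ty T T (Var 0)) (TTrunc (alg_injective_ty T T (Var 0)))))"
    by (simp add: main_ty_def imp_def piU_def pi_def iff_def injective_def alg_injective_def
        trunc_def resizing_def bvar_def univ_def derived_ty_defs map_tm_ops)
  ultimately show ?thesis by auto
qed

end
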